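(* Let $(a,b)\in\mathcal{S}$. Let $v\in T^1M$, let $\gamma_v$ be the corresponding geodesic in $M$, let $\tilde\gamma_v$ be one of its lifts to $\mathbb{H}$, and let $x$ be the attracting endpoint of $\tilde\gamma_v$. Assume that $x$ is an irrational real number, with $(a,b)$-continued fraction expansion $x=[a_0,a_1,a_2,\ldots]_{a,b}$. For $\xi>1$ and $N\ge 1$ put $$A_N^{(\xi)}=\frac1N\sum_{j=0}^{N-1}\log|a_j^{(\xi)}|,\qquad A_N=\frac1N\sum_{j=0}^{N-1}\log|a_j|,$$ where $a_j^{(\xi)}=a_j$ if $|a_j|>\xi$ and $a_j^{(\xi)}=1$ if $|a_j|\le\xi$ (and, if $a_0=0$, the term $\log|a_0|$ in $A_N$ is read as $0$). Then: (i) the forward orbit $\{g_tv\}_{t\ge0}$ visits the cusp with frequency $0$ if and only if there is some $\xi>1$ such that $A_N^{(\xi)}\to0$ as $N\to\infty$; (ii) the forward orbit $\{g_tv\}_{t\ge0}$ visits the cusp with frequency $1$ if and only if $A_N\to\infty$ as $N\to\infty$.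
   Context: Geometry. $\mathbb{H}=\{x+iy:y>0\}$ is the upper half plane with metric $ds^2=(dx^2+dy^2)/y^2$; $\mathrm{PSL}(2,\mathbb{Z})$ acts on it by fractional linear transformations and on the unit tangent bundle $T^1\mathbb{H}$. $M=\mathbb{H}/\mathrm{PSL}(2,\mathbb{Z})$ is the modular surface, and $T^1M:=T^1\mathbb{H}/\mathrm{PSL}(2,\mathbb{Z})$. $\pi$ denotes both projections $\mathbb{H}\to M$ and $T^1\mathbb{H}\to T^1M$. $g_t$ is the (unit speed) geodesic flow on $T^1M$. Each $v\in T^1M$ determines an oriented geodesic $\gamma_v$ in $M$ (the projection of $\{g_tv\}_{t\in\mathbb{R}}$); a lift $\tilde\gamma_v$ is an oriented geodesic of $\mathbb{H}$ projecting to it, and its attracting (resp. repelling) endpoint in $\mathbb{R}\cup\{\infty\}$ is its limit as $t\to+\infty$ (resp. $t\to-\infty$). Cusp neighbourhoods. For $d>1$, $\overline{\mathbb{H}}_d\subset T^1\mathbb{H}$ is the set of unit tangent vectors whose base point has imaginary part $>d$, and $\overline{M}_d=\pi(\overline{\mathbb{H}}_d)$. The orbit $\{g_tv\}_{t\ge0}$ visits the cusp with frequency $0$ if there exists some $d>1$ with $\frac1T\int_0^T\chi_{\overline{M}_d}(g_tv)\,dt\to0$ as $T\to\infty$. It visits the cusp with frequency $1$ if for all $d>1$, $\frac1T\int_0^T\chi_{\overline{M}_d}(g_tv)\,dt\to1$ as $T\to\infty$. Here $\chi_A$ is the characteristic function of $A$. Parameters. $\mathcal{P}=\{(a,b)\in\mathbb{R}^2: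 -1\le a<0<b\le1,\ b-a\ge1\}$. Write $T(x)=x+1$, $S(x)=-1/x$ and define $f_{a,b}:\mathbb{R}\cup\{\infty\}\to\mathbb{R}\cup\{\infty\}$ by $f_{a,b}(x)=x+1$ if $x<a$, $-1/x$ if $a\le x<b$, $x-1$ if $x\ge b$ (with $\infty$ fixed). The upper and lower orbits of $a$ are the $f_{a,b}$-orbits of $Sa$ and $Ta$; the upper and lower orbits of $b$ are the $f_{a,b}$-orbits of $T^{-1}b$ and $Sb$. The point $a$ (resp. $b$) has the cycle property if there are integers $k,m\ge0$ with $f_{a,b}^{m}(Sa)=f_{a,b}^{k}(Ta)$ (resp. $f_{a,b}^{m}(T^{-1}b)=f_{a,b}^{k}(Sb)$), i.e. the two orbits meet, forming a cycle. It has the strong cycle property if moreover the products of the transformations ($T$, $T^{-1}$, $S$) applied along the upper side (starting with $S$, resp. $T^{-1}$, applied to $a$, resp. $b$) and along the lower side (starting with $T$, resp. $S$) of the cycle are equal as elements of $\mathrm{PSL}(2,\mathbb{Z})$; otherwise it has the weak cycle property. The finiteness condition for $(a,b)$ says that for each of $a$ and $b$, either the upper and lower orbits are both eventually periodic or the cycle property holds; $\mathcal{E}\subset\mathcal{P}$ is the exceptional set of parameters not satisfying the finiteness condition. Put $\mathfrak{S}=\{(a,b)\in\mathcal{P}\setminus\mathcal{E}: a\text{ and }b\text{ have the strong cycle property}\}$ and $\mathcal{S}=\mathfrak{S}\cup\{(-1,1),(-\tfrac12,\tfrac12)\}$. $(a,b)$-continued fractions. Let $[x]$ be the largest integer $\le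 x$ and $\lceil x\rceil:=[x]+1$. Put $[x]_{a,b}=[x-a]$ if $x<a$, $0$ if $a\le x<b$, $\lceil x-b\rceil$ if $x\ge b$. For irrational $x$ set $x_0=x$, $a_0=[x_0]_{a,b}$, and $x_j=-\dfrac1{x_{j-1}-a_{j-1}}$, $a_j=[x_j]_{a,b}$ for $j\ge1$. Then $a_j\in\mathbb{Z}$, $a_j\neq0$ for $j\ge1$, and $x=a_0-\cfrac{1}{a_1-\cfrac{1}{a_2-\cdots}}$, written $x=[a_0,a_1,a_2,\ldots]_{a,b}$; the $a_j$ are the partial quotients. *)

theory Defs
  imports "HOL-Analysis.Analysis"
begin

section \<open>The unit tangent bundle of the hyperbolic plane and its geodesic flow\<close>

text \<open>A tangent vector of the upper half plane is a pair \<open>(z, w)\<close> of its base point and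
  its direction; its length for \<open>ds\<^sup>2 = (dx\<^sup>2 + dy\<^sup>2) / y\<^sup>2\<close> is \<open>\<bar>w\<bar> / Im z\<close>.\<close>

type_synonym tvec = "complex \<times> complex"

definition hyp_norm :: "tvec \<Rightarrow> real" where
  "hyp_norm u = norm (snd u) / Im (fst u)"

definition T1H :: "tvec set" where
  "T1H = {u. Im (fst u) > 0 \<and> hyp_norm u = 1}"

definition velocity :: "(real \<Rightarrow> complex) \<Rightarrow> real \<Rightarrow> tvec" where
  "velocity c t = (c t, vector_derivative c (at t))"

text \<open>Unit speed geodesics.  The last conjunct is the geodesic equation of the metric,
  \<open>x'' = 2 x' y' / y\<close> and \<open>y'' = (y'\<^sup>2 - x'\<^sup>2) / y\<close>, in complex form.\<close>

definition hyp_geodesic :: "(real \<Rightarrow> complex) \<Rightarrow> bool" where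
  "hyp_geodesic c \<longleftrightarrow> (\<exists>c' c''. \<forall>t.
     (c has_vector_derivative c' t) (at t) \<and>
     (c' has_vector_derivative c'' t) (at t) \<and>
     (c t, c' t) \<in> T1H \<and>
     c'' t = - (\<i> / complex_of_real (Im (c t))) * (c' t)\<^sup>2)"

text \<open>Every vector of \<open>T1H\<close> is the initial velocity of exactly one \<open>hyp_geodesic\<close>, so the
  description below determines the flow on \<open>T1H\<close>.\<close>

definition flowH :: "real \<Rightarrow> tvec \<Rightarrow> tvec" where
  "flowH t u = (THE u'. \<exists>c. hyp_geodesic c \<and> velocity c 0 = u \<and> velocity c t = u')"

section \<open>The modular surface\<close>

text \<open>Elements of \<open>PSL(2,\<int>)\<close> are represented by integer matrices of determinant 1, which
  are identified up to sign.\<close>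

definition moebius_tvec :: "int^2^2 \<Rightarrow> tvec \<Rightarrow> tvec" where
  "moebius_tvec A u =
     ((of_int (A$1$1) * fst u + of_int (A$1$2)) / (of_int (A$2$1) * fst u + of_int (A$2$2)),
      snd u / (of_int (A$2$1) * fst u + of_int (A$2$2))\<^sup>2)"

definition PSL2Z_rel :: "tvec rel" where
  "PSL2Z_rel = {(u, u'). u \<in> T1H \<and> (\<exists>A. det A = 1 \<and> u' = moebius_tvec A u)}"

definition T1M :: "tvec set set" where
  "T1M = T1H // PSL2Z_rel"

definition proj :: "tvec \<Rightarrow> tvec set" where
  "proj u = PSL2Z_rel `` {u}"

text \<open>The flow on \<open>T1H\<close> commutes with \<open>PSL(2,\<int>)\<close>, so the image of an orbit is an orbit.\<close>

definition flowM :: "real \<Rightarrow> tvec set \<Rightarrow> tvec set" where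
  "flowM t v = flowH t ` v"

text \<open>Oriented geodesics are treated as sets of unit tangent vectors, which records the
  orientation.\<close>

definition is_lift :: "(real \<Rightarrow> complex) \<Rightarrow> tvec set \<Rightarrow> bool" where
  "is_lift c v \<longleftrightarrow> hyp_geodesic c \<and> proj ` range (velocity c) = range (\<lambda>t. flowM t v)"

definition cuspH :: "real \<Rightarrow> tvec set" where
  "cuspH d = {u \<in> T1H. Im (fst u) > d}"

definition cuspM :: "real \<Rightarrow> tvec set set" where
  "cuspM d = proj ` cuspH d"

definition cusp_average :: "real \<Rightarrow> tvec set \<Rightarrow> real \<Rightarrow> real" where
  "cusp_average d v L = 1 / L * integral {0..L} (\<lambda>t. indicator (cuspM d) (flowM t v))"

definition cusp_frequency_0 :: "tvec set \<Rightarrow> bool" where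
  "cusp_frequency_0 v \<longleftrightarrow> (\<exists>d>1. (cusp_average d v \<longlongrightarrow> 0) at_top)"

definition cusp_frequency_1 :: "tvec set \<Rightarrow> bool" where
  "cusp_frequency_1 v \<longleftrightarrow> (\<forall>d>1. (cusp_average d v \<longlongrightarrow> 1) at_top)"

section \<open>The parameters\<close>

definition params :: "(real \<times> real) set" where
  "params = {(a, b). -1 \<le> a \<and> a < 0 \<and> 0 < b \<and> b \<le> 1 \<and> b - a \<ge> 1}"

text \<open>The point \<open>\<infinity>\<close> of \<open>\<real> \<union> {\<infinity>}\<close> is \<open>None\<close>.\<close>

fun mapS :: "real option \<Rightarrow> real option" where
  "mapS None = Some 0"
| "mapS (Some x) = (if x = 0 then None else Some (- 1 / x))"

fun fab :: "real \<Rightarrow> real \<Rightarrow> real option \<Rightarrow> real option" where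
  "fab a b None = None"
| "fab a b (Some x) =
     (if x < a then Some (x + 1) else if x < b then mapS (Some x) else Some (x - 1))"

definition matT :: "int^2^2" where
  "matT = vector [vector [1, 1], vector [0, 1]]"

definition matTinv :: "int^2^2" where
  "matTinv = vector [vector [1, -1], vector [0, 1]]"

definition matS :: "int^2^2" where
  "matS = vector [vector [0, -1], vector [1, 0]]"

text \<open>The transformation that \<open>fab a b\<close> applies at a point; since \<open>\<infinity>\<close> is merely kept fixed,
  no transformation is recorded there.\<close>

fun step_mat :: "real \<Rightarrow> real \<Rightarrow> real option \<Rightarrow> int^2^2" where
  "step_mat a b None = mat 1"
| "step_mat a b (Some x) = (if x < a then matT else if x < b then matS else matTinv)"

primrec orbit_mat :: "real \<Rightarrow> real \<Rightarrow> real option \<Rightarrow> nat \<Rightarrow> int^2^2" where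
  "orbit_mat a b y 0 = mat 1"
| "orbit_mat a b y (Suc n) = step_mat a b ((fab a b ^^ n) y) ** orbit_mat a b y n"

definition PSL_eq :: "int^2^2 \<Rightarrow> int^2^2 \<Rightarrow> bool" where
  "PSL_eq A B \<longleftrightarrow> A = B \<or> A = - B"

text \<open>In the following, the integers \<open>m\<close> and \<open>k\<close> of a cycle are not required to be minimal, and
  \<open>y\<close> and \<open>z\<close> are the starting points of the upper and the lower orbit, and
  \<open>U\<close> and \<open>L\<close> are the transformations that produce them.\<close>

definition has_cycle :: "real \<Rightarrow> real \<Rightarrow> real option \<Rightarrow> real option \<Rightarrow> bool" where
  "has_cycle a b y z \<longleftrightarrow> (\<exists>m k. (fab a b ^^ m) y = (fab a b ^^ k) z)"

definition has_strong_cycle ::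
    "real \<Rightarrow> real \<Rightarrow> int^2^2 \<Rightarrow> real option \<Rightarrow> int^2^2 \<Rightarrow> real option \<Rightarrow> bool" where
  "has_strong_cycle a b U y L z \<longleftrightarrow> (\<exists>m k.
     (fab a b ^^ m) y = (fab a b ^^ k) z \<and>
     PSL_eq (orbit_mat a b y m ** U) (orbit_mat a b z k ** L))"

definition eventually_periodic :: "real \<Rightarrow> real \<Rightarrow> real option \<Rightarrow> bool" where
  "eventually_periodic a b y \<longleftrightarrow> (\<exists>n p. p > 0 \<and> (fab a b ^^ (n + p)) y = (fab a b ^^ n) y)"

definition finite_or_cycle :: "real \<Rightarrow> real \<Rightarrow> real option \<Rightarrow> real option \<Rightarrow> bool" where
  "finite_or_cycle a b y z \<longleftrightarrow>
     eventually_periodic a b y \<and> eventually_periodic a b z \<or> has_cycle a b y z"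

definition finiteness_condition :: "real \<Rightarrow> real \<Rightarrow> bool" where
  "finiteness_condition a b \<longleftrightarrow>
     finite_or_cycle a b (mapS (Some a)) (Some (a + 1)) \<and>
     finite_or_cycle a b (Some (b - 1)) (mapS (Some b))"

definition exceptional_params :: "(real \<times> real) set" where
  "exceptional_params = {(a, b) \<in> params. \<not> finiteness_condition a b}"

definition strong_params :: "(real \<times> real) set" where
  "strong_params = {(a, b) \<in> params - exceptional_params.
     has_strong_cycle a b matS (mapS (Some a)) matT (Some (a + 1)) \<and>
     has_strong_cycle a b matTinv (Some (b - 1)) matS (mapS (Some b))}"

definition admissible_params :: "(real \<times> real) set" where
  "admissible_params = strong_params \<union> {(-1, 1), (-1/2, 1/2)}"

section \<open>The continued fractions\<close>

definition floor_ab :: "real \<Rightarrow> real \<Rightarrow> real \<Rightarrow> int" where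
  "floor_ab a b x = (if x < a then \<lfloor>x - a\<rfloor> else if x < b then 0 else \<lfloor>x - b\<rfloor> + 1)"

primrec cf_remainder :: "real \<Rightarrow> real \<Rightarrow> real \<Rightarrow> nat \<Rightarrow> real" where
  "cf_remainder a b x 0 = x"
| "cf_remainder a b x (Suc j) =
     - 1 / (cf_remainder a b x j - of_int (floor_ab a b (cf_remainder a b x j)))"

definition cf_quotient :: "real \<Rightarrow> real \<Rightarrow> real \<Rightarrow> nat \<Rightarrow> int" where
  "cf_quotient a b x j = floor_ab a b (cf_remainder a b x j)"

definition cf_quotient_trunc :: "real \<Rightarrow> real \<Rightarrow> real \<Rightarrow> real \<Rightarrow> nat \<Rightarrow> int" where
  "cf_quotient_trunc \<xi> a b x j =
     (if \<bar>real_of_int (cf_quotient a b x j)\<bar> > \<xi> then cf_quotient a b x j else 1)"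

definition log_average :: "(nat \<Rightarrow> int) \<Rightarrow> nat \<Rightarrow> real" where
  "log_average q N =
     1 / real N * (\<Sum>j<N. if q j = 0 then 0 else ln \<bar>real_of_int (q j)\<bar>)"

end

theory Submission
  imports Defs
begin

text \<open>
  Why the theorem is true.  All unit speed geodesics of the upper half plane are explicit, and one
  that ends at \<open>x\<close> is asymptotic to a vertical geodesic \<open>x + \<i> r e\<^sup>-\<^sup>t\<close>
  (\<open>cusp_asymptotics\<close>).  A point \<open>z\<close> projects into the cusp neighbourhood of level \<open>d\<close> iff
  \<open>Im z / \<bar>m z + n\<bar>\<^sup>2 > d\<close> for some coprime \<open>m\<close>, \<open>n\<close> (\<open>proj_in_cuspM_iff\<close>), and the passage to the
  vertical geodesic eventually changes these heights by a factor of at most 2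
  (\<open>cusp_height_compare\<close>).  So it suffices to watch the heights along the vertical geodesic.

  The expansion of \<open>x\<close> supplies the cusps that matter.  With the convergents \<open>p\<^sub>j / q\<^sub>j\<close> and the
  remainders \<open>x\<^sub>j\<close>, the map \<open>z \<mapsto> (q\<^sub>j\<^sub>-\<^sub>1 z - p\<^sub>j\<^sub>-\<^sub>1) / (q\<^sub>j z - p\<^sub>j)\<close> belongs to \<open>PSL(2,\<int>)\<close>; it
  sends \<open>x\<close> to \<open>x\<^sub>j\<^sub>+\<^sub>1\<close> and \<open>\<infinity>\<close> to the pole \<open>q\<^sub>j\<^sub>-\<^sub>1 / q\<^sub>j\<close>.  The digits obey a restriction: of two
  consecutive ones of equal sign the second is at least 2 in absolute value, and then the
  corresponding remainder keeps away from \<open>\<plusminus>1\<close> (\<open>same_sign\<close>).  Hence the poles lie in \<open>[-1, 1]\<close>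
  and the distance from \<open>x\<^sub>j\<^sub>+\<^sub>1\<close> to the pole is at least \<open>\<kappa> \<bar>x\<^sub>j\<^sub>+\<^sub>1\<bar>\<close> with \<open>\<kappa> = min b (-a) > 0\<close>.  The
  vertical geodesic is therefore mapped to a half circle whose diameter is comparable to \<open>\<bar>x\<^sub>j\<^sub>+\<^sub>1\<bar>\<close>,
  and so to \<open>\<bar>a\<^sub>j\<^sub>+\<^sub>1\<bar>\<close>.

  Cut the vertical geodesic at the times \<open>\<sigma>\<^sub>j = ln r + 2 (ln \<bar>x\<^sub>1\<bar> + \<dots> + ln \<bar>x\<^sub>j\<bar>)\<close>.  The segment between
  \<open>\<sigma>\<^sub>j\<close> and \<open>\<sigma>\<^sub>j\<^sub>+\<^sub>1\<close>, of length \<open>2 ln \<bar>x\<^sub>j\<^sub>+\<^sub>1\<bar>\<close>, is the climb and descent along that half circle.  For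
  every level \<open>d\<close> all of it, up to two end pieces of bounded length, is in the cusp
  (\<open>excursion\<close>); if \<open>\<bar>a\<^sub>j\<^sub>+\<^sub>1\<bar> \<le> \<xi>\<close>, then no point of it is above a level that depends only on \<open>\<xi>\<close> and \<open>\<kappa>\<close>
  (\<open>no_excursion\<close>), because no point is high over two cusps at once (\<open>cusp_heights_exclusive\<close>).
  Moreover two consecutive segments have a total length that is bounded below (\<open>ln_X_pair\<close>), so the
  times grow at least linearly.

  What remains is a comparison of three quantities up to step \<open>N\<close>: the number \<open>N\<close> of segments, the
  elapsed time \<open>\<sigma>\<^sub>N\<close>, and the time in the cusp.  The latter differs by \<open>O(N)\<close> from \<open>\<sigma>\<^sub>N\<close>, and if the level
  and the bound \<open>\<xi>\<close> are matched, the sum of \<open>ln \<bar>a\<^sub>j\<bar>\<close> over the digits above \<open>\<xi>\<close> bounds it, or is bounded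
  by it, up to a factor.  Frequency 0 says that this sum is \<open>o(N)\<close>;
  frequency 1 says that \<open>N = o(\<sigma>\<^sub>N)\<close>, and \<open>\<sigma>\<^sub>N\<close> is, up to \<open>O(N)\<close>, twice the sum of all \<open>ln \<bar>a\<^sub>j\<bar>\<close>.  The
  locale \<open>excursion_times\<close> carries out this comparison.
\<close>

section \<open>Unit speed geodesics of the upper half plane\<close>

text \<open>
  Along a geodesic \<open>1 / Im c\<close> solves \<open>f'' = f\<close>, so it is \<open>A e\<^sup>-\<^sup>t + B e\<^sup>t\<close>, and \<open>k = Re c' / (Im c)\<^sup>2\<close> is
  a constant of the motion (the Clairaut integral of horizontal translations).  The real part is the
  integral of \<open>k (Im c)\<^sup>2\<close>, written in a form that also covers \<open>k = 0\<close> and \<open>A = 0\<close> or \<open>B = 0\<close>.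
\<close>

definition geo :: "real \<Rightarrow> real \<Rightarrow> real \<Rightarrow> real \<Rightarrow> real \<Rightarrow> complex" where
  "geo x0 k A B t = Complex (x0 + k / 2 * (exp (2 * t) - 1) / ((A + B) * (A + B * exp (2 * t))))
                            (exp t / (A + B * exp (2 * t)))"

definition geo_velocity :: "real \<Rightarrow> real \<Rightarrow> real \<Rightarrow> real \<Rightarrow> complex" where
  "geo_velocity k A B t = of_real ((exp t / (A + B * exp (2 * t)))\<^sup>2) * Complex k (A * exp (- t) - B * exp t)"

text \<open>
  The relation \<open>4 A B = k\<^sup>2\<close> expresses unit speed.
\<close>

definition geo_data :: "real \<Rightarrow> real \<Rightarrow> real \<Rightarrow> bool" where
  "geo_data k A B \<longleftrightarrow> 0 \<le> A \<and> 0 \<le> B \<and> 0 < A + B \<and> 4 * A * B = k\<^sup>2"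

lemma geo_denom_pos:
  assumes "geo_data k A B"
  shows "A + B * exp (t::real) > 0"
proof (cases "B = 0")
  case False
  with assms show ?thesis by (auto simp: geo_data_def intro: add_nonneg_pos)
qed (use assms in \<open>auto simp: geo_data_def\<close>)

lemma exp_double_real: "exp (2 * t) = (exp t)\<^sup>2" for t :: real
  by (simp add: exp_double)

lemma has_vector_derivative_Complex:
  assumes "(f has_real_derivative f') (at t)" "(g has_real_derivative g') (at t)"
  shows "((\<lambda>t. Complex (f t) (g t)) has_vector_derivative Complex f' g') (at t)"
  using assms unfolding has_vector_derivative_complex_iff by (simp add: has_real_derivative_iff_has_vector_derivative o_def)

lemma geo_deriv:
  fixes x0 t :: real
  assumes "geo_data k A B"
  shows "(geo x0 k A B has_vector_derivative geo_velocity k A B t) (at t)"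
proof -
  have pos: "A + B * exp (2 * t) > 0" "A + B > 0" for t
    using geo_denom_pos[OF assms] assms by (auto simp: geo_data_def)
  then have ne: "A + B * exp (2 * t) \<noteq> 0" "A + B \<noteq> 0" for t by (metis less_irrefl)+
  have e: "exp (- t) = exp t / exp (2 * t)" by (simp flip: exp_diff)
  have 1: "((\<lambda>t. x0 + k / 2 * (exp (2 * t) - 1) / ((A + B) * (A + B * exp (2 * t)))) has_real_derivative
        k * (exp t / (A + B * exp (2 * t)))\<^sup>2) (at t)"
    using ne(1)[of t] ne(2) unfolding exp_double_real
    by (auto intro!: derivative_eq_intros) (simp add: divide_simps power2_eq_square; algebra)
  have 2: "((\<lambda>t. exp t / (A + B * exp (2 * t))) has_real_derivative
        (exp t / (A + B * exp (2 * t)))\<^sup>2 * (A * exp (- t) - B * exp t)) (at t)"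
    using ne(1)[of t] ne(2) unfolding e exp_double_real
    by (auto intro!: derivative_eq_intros) (simp add: divide_simps power2_eq_square; algebra)
  have "geo_velocity k A B t = Complex (k * (exp t / (A + B * exp (2 * t)))\<^sup>2)
      ((exp t / (A + B * exp (2 * t)))\<^sup>2 * (A * exp (- t) - B * exp t))"
    by (simp add: geo_velocity_def complex_eq_iff)
  then show ?thesis
    using has_vector_derivative_Complex[OF 1 2] by (simp add: geo_def [abs_def])
qed

lemma geo_hyp_geodesic:
  assumes "geo_data k A B"
  shows "hyp_geodesic (geo x0 k A B)"
proof -
  have pos: "A + B * exp (2 * t) > 0" "A + B > 0" for t
    using geo_denom_pos[OF assms] assms by (auto simp: geo_data_def)
  have k: "4 * A * B = k\<^sup>2" using assms by (simp add: geo_data_def)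
  define y where "y t = exp t / (A + B * exp (2 * t))" for t
  define q where "q t = A * exp (- t) - B * exp t" for t
  have ypos: "y t > 0" for t using pos(1)[of t] by (simp add: y_def)
  have yinv: "1 / y t = A * exp (- t) + B * exp t" for t
    using pos(1)[of t] unfolding y_def exp_double_real by (simp add: exp_minus field_simps power2_eq_square)
  have qk: "(y t)\<^sup>2 * ((q t)\<^sup>2 + k\<^sup>2) = 1" for t
  proof -
    have "exp (- t) * exp t = 1" by (simp add: exp_minus)
    then have "(q t)\<^sup>2 + k\<^sup>2 = (A * exp (- t) + B * exp t)\<^sup>2"
      unfolding q_def k[symmetric] unfolding power2_eq_square by algebra
    then show ?thesis unfolding yinv[symmetric] using ypos[of t] by (simp add: power_divide)
  qed
  have dy: "(y has_real_derivative (y t)\<^sup>2 * q t) (at t)" for t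
  proof -
    have "((\<lambda>t. Im (geo x0 k A B t)) has_real_derivative Im (geo_velocity k A B t)) (at t)"
      using geo_deriv[OF assms, of x0 t]
      unfolding has_vector_derivative_complex_iff has_real_derivative_iff_has_vector_derivative by simp
    then show ?thesis by (simp add: geo_def geo_velocity_def y_def[abs_def] q_def)
  qed
  have dq: "(q has_real_derivative - 1 / y t) (at t)" for t
  proof -
    have "(q has_real_derivative - (A * exp (- t) + B * exp t)) (at t)"
      unfolding q_def[abs_def] by (auto intro!: derivative_eq_intros)
    then show ?thesis unfolding yinv[symmetric] by simp
  qed
  define c'' where "c'' t = Complex (2 * y t * ((y t)\<^sup>2 * q t) * k)
      (2 * y t * ((y t)\<^sup>2 * q t) * q t - y t)" for t
  have g': "geo_velocity k A B t = Complex ((y t)\<^sup>2 * k) ((y t)\<^sup>2 * q t)" for t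
    by (simp add: geo_velocity_def complex_eq_iff y_def q_def)
  have dg': "(geo_velocity k A B has_vector_derivative c'' t) (at t)" for t
  proof -
    have 1: "((\<lambda>t. (y t)\<^sup>2 * k) has_real_derivative 2 * y t * ((y t)\<^sup>2 * q t) * k) (at t)"
      by (auto intro!: derivative_eq_intros dy)
    have 2: "((\<lambda>t. (y t)\<^sup>2 * q t) has_real_derivative 2 * y t * ((y t)\<^sup>2 * q t) * q t - y t) (at t)"
      using ypos[of t] by (auto intro!: derivative_eq_intros dy dq simp: power2_eq_square)
    show ?thesis
      unfolding c''_def using has_vector_derivative_Complex[OF 1 2] by (simp add: g'[abs_def])
  qed
  have im: "Im (geo x0 k A B t) = y t" for t by (simp add: geo_def y_def)
  have nrm: "norm (geo_velocity k A B t) = y t" for t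
  proof -
    have "(norm (geo_velocity k A B t))\<^sup>2 = (y t)\<^sup>2 * ((y t)\<^sup>2 * ((q t)\<^sup>2 + k\<^sup>2))"
      unfolding cmod_power2 g' by (simp add: algebra_simps power_mult_distrib power2_eq_square)
    also have "\<dots> = (y t)\<^sup>2" by (simp add: qk)
    finally show ?thesis using ypos[of t] by (simp add: less_imp_le)
  qed
  have ode: "c'' t = - (\<i> / complex_of_real (y t)) * (geo_velocity k A B t)\<^sup>2" for t
  proof -
    have *: "(y t)^4 * ((q t)\<^sup>2 + k\<^sup>2) = (y t)\<^sup>2"
      using qk[of t] by (simp add: power2_eq_square power4_eq_xxxx)
    have h: "complex_of_real (y t) * c'' t = - \<i> * (geo_velocity k A B t)\<^sup>2"
      using * by (simp add: complex_eq_iff c''_def g' power2_eq_square power4_eq_xxxx algebra_simps)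
    have "c'' t = (complex_of_real (y t) * c'' t) / complex_of_real (y t)"
      using ypos[of t] by simp
    then show ?thesis unfolding h by simp
  qed
  show ?thesis unfolding hyp_geodesic_def
    by (rule exI[of _ "geo_velocity k A B"], rule exI[of _ c''])
      (use geo_deriv[OF assms] dg' ode ypos nrm in
        \<open>auto simp: T1H_def hyp_norm_def im less_imp_neq[THEN not_sym]\<close>)
qed

text \<open>
  The coefficients are those of the solution \<open>A e\<^sup>-\<^sup>t + B e\<^sup>t\<close> of \<open>f'' = f\<close> with initial value \<open>1 / y\<close>
  and initial slope \<open>- Im w / y\<^sup>2\<close>.
\<close>

lemma geo_data_of_tvec:
  assumes "y > 0" "norm w = y"
  shows "geo_data (Re w / y\<^sup>2) ((1 / y + Im w / y\<^sup>2) / 2) ((1 / y - Im w / y\<^sup>2) / 2)"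
proof -
  have nrm: "(Re w)\<^sup>2 = y\<^sup>2 - (Im w)\<^sup>2" by (simp add: assms(2)[symmetric] cmod_power2)
  have "\<bar>Im w\<bar> \<le> y" unfolding assms(2)[symmetric] by (rule abs_Im_le_cmod)
  then have "\<bar>Im w / y\<^sup>2\<bar> \<le> 1 / y" using assms by (simp add: abs_divide field_simps power2_eq_square)
  then have "1 / y + Im w / y\<^sup>2 \<ge> 0" "1 / y - Im w / y\<^sup>2 \<ge> 0" by linarith+
  moreover have "4 * ((1 / y + Im w / y\<^sup>2) / 2) * ((1 / y - Im w / y\<^sup>2) / 2) = (Re w / y\<^sup>2)\<^sup>2"
    unfolding power_divide nrm using assms by (simp add: field_simps power2_eq_square)
  moreover have "(1 / y + Im w / y\<^sup>2) / 2 + (1 / y - Im w / y\<^sup>2) / 2 = 1 / y" by (simp add: field_simps)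
  ultimately show ?thesis unfolding geo_data_def using assms(1) by simp
qed

text \<open>
  With \<open>P + \<i> Q\<close> the velocity and \<open>Y\<close> the height, the geodesic equation and unit speed turn
  \<open>1 / Y\<close> and \<open>Q / Y\<^sup>2\<close> into a linear system, each being minus the derivative of the other, whose
  first integrals, together with \<open>P / Y\<^sup>2\<close>, determine the geodesic.
\<close>

lemma hyp_geodesic_eq_geo:
  assumes "hyp_geodesic c"
  defines "y \<equiv> Im (c 0)" and "w \<equiv> snd (velocity c 0)"
  defines "k \<equiv> Re w / y\<^sup>2" and "A \<equiv> (1 / y + Im w / y\<^sup>2) / 2" and "B \<equiv> (1 / y - Im w / y\<^sup>2) / 2"
  shows "geo_data k A B" "c = geo (Re (c 0)) k A B"
proof -
  obtain c' c'' where c: "\<And>t. (c has_vector_derivative c' t) (at t)"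
     "\<And>t. (c' has_vector_derivative c'' t) (at t)"  "\<And>t. (c t, c' t) \<in> T1H"
     "\<And>t. c'' t = - (\<i> / complex_of_real (Im (c t))) * (c' t)\<^sup>2"
    using assms(1) unfolding hyp_geodesic_def by metis
  define Y P Q where "Y t = Im (c t)" and "P t = Re (c' t)" and "Q t = Im (c' t)" for t
  have w: "w = c' 0" using c(1)[of 0] unfolding w_def velocity_def by (simp add: vector_derivative_at)
  have Ypos: "Y t > 0" and nrm: "(P t)\<^sup>2 + (Q t)\<^sup>2 = (Y t)\<^sup>2" for t
  proof -
    show "Y t > 0" using c(3)[of t] by (simp add: T1H_def Y_def)
    then show "(P t)\<^sup>2 + (Q t)\<^sup>2 = (Y t)\<^sup>2" using c(3)[of t]
      by (simp add: T1H_def hyp_norm_def P_def Q_def Y_def cmod_power2[symmetric])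
  qed
  have dY: "(Y has_real_derivative Q t) (at t)"
   and dX: "((\<lambda>t. Re (c t)) has_real_derivative P t) (at t)" for t
    using c(1)[of t] unfolding has_vector_derivative_complex_iff has_real_derivative_iff_has_vector_derivative
    by (simp_all add: Y_def[abs_def] P_def Q_def)
  have c'': "Re (c'' t) = 2 * P t * Q t / Y t" "Im (c'' t) = ((Q t)\<^sup>2 - (P t)\<^sup>2) / Y t" for t
  proof -
    have "complex_of_real (Y t) * c'' t = - \<i> * (c' t)\<^sup>2" using Ypos[of t] by (simp add: c(4) Y_def[symmetric])
    then have "Y t * Re (c'' t) = 2 * P t * Q t" "Y t * Im (c'' t) = (Q t)\<^sup>2 - (P t)\<^sup>2"
      by (simp_all add: complex_eq_iff P_def Q_def power2_eq_square)
    then show "Re (c'' t) = 2 * P t * Q t / Y t" "Im (c'' t) = ((Q t)\<^sup>2 - (P t)\<^sup>2) / Y t"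
      using Ypos[of t] by (simp_all add: field_simps)
  qed
  have dP: "(P has_real_derivative 2 * P t * Q t / Y t) (at t)"
   and dQ: "(Q has_real_derivative ((Q t)\<^sup>2 - (P t)\<^sup>2) / Y t) (at t)" for t
    using c(2)[of t] unfolding has_vector_derivative_complex_iff has_real_derivative_iff_has_vector_derivative
    by (simp_all add: Q_def[abs_def] P_def[abs_def] c''[unfolded P_def Q_def])
  have Yne: "Y t \<noteq> 0" for t using Ypos[of t] by simp
  have "((\<lambda>t. P t / (Y t)\<^sup>2) has_real_derivative 0) (at t)" for t
    using Yne[of t] by (auto intro!: derivative_eq_intros dY dP simp: field_simps power2_eq_square power4_eq_xxxx)
  then have PY: "P t / (Y t)\<^sup>2 = P 0 / (Y 0)\<^sup>2" for t
    by (rule DERIV_isconst_all[rule_format]) 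
  then have Pk: "P t = k * (Y t)\<^sup>2" for t
  proof -
    have "P t = P t / (Y t)\<^sup>2 * (Y t)\<^sup>2" using Yne[of t] by simp
    also have "P t / (Y t)\<^sup>2 = P 0 / (Y 0)\<^sup>2" by (rule PY)
    finally show ?thesis by (simp add: k_def w y_def P_def Y_def)
  qed
  have dI: "((\<lambda>t. 1 / Y t) has_real_derivative - Q t / (Y t)\<^sup>2) (at t)" for t
    using Yne[of t] by (auto intro!: derivative_eq_intros dY simp: power2_eq_square)
  have dR: "((\<lambda>t. Q t / (Y t)\<^sup>2) has_real_derivative - 1 / Y t) (at t)" for t
  proof -
    have "(Q has_real_derivative (2 * (Q t)\<^sup>2 - (Y t)\<^sup>2) / Y t) (at t)"
      using dQ[of t] nrm[of t, symmetric] by simp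
    then show ?thesis using Yne[of t]
      by (auto intro!: derivative_eq_intros dY simp: field_simps power2_eq_square)
  qed
  have "((\<lambda>t. (1 / Y t + Q t / (Y t)\<^sup>2) * exp t) has_real_derivative 0) (at t)" for t
    using DERIV_mult[OF DERIV_add[OF dI dR] DERIV_exp] by (simp add: algebra_simps)
  then have "(1 / Y t + Q t / (Y t)\<^sup>2) * exp t = (1 / Y 0 + Q 0 / (Y 0)\<^sup>2) * exp 0" for t
    by (rule DERIV_isconst_all[rule_format])
  then have E1: "(1 / Y t + Q t / (Y t)\<^sup>2) * exp t = 2 * A" for t
    by (simp add: A_def w y_def Y_def Q_def)
  have "((\<lambda>t. (1 / Y t - Q t / (Y t)\<^sup>2) * exp (- t)) has_real_derivative 0) (at t)" for t
    by (rule DERIV_cong[OF DERIV_mult[OF DERIV_diff[OF dI dR] DERIV_chain2[OF DERIV_exp DERIV_minus[OF DERIV_ident]]]])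
       (simp add: algebra_simps)
  then have "(1 / Y t - Q t / (Y t)\<^sup>2) * exp (-t) = (1 / Y 0 - Q 0 / (Y 0)\<^sup>2) * exp (-0)" for t
    by (rule DERIV_isconst_all[rule_format])
  then have E2: "(1 / Y t - Q t / (Y t)\<^sup>2) * exp (-t) = 2 * B" for t
    by (simp add: B_def w y_def Y_def Q_def)
  have y0: "y > 0" using Ypos[of 0] by (simp add: Y_def y_def)
  have "norm w = y" using c(3)[of 0] y0 by (simp add: w y_def T1H_def hyp_norm_def)
  then show gd: "geo_data k A B" unfolding k_def A_def B_def by (rule geo_data_of_tvec[OF y0])
  have pos: "A + B * exp (2 * t) > 0" for t using geo_denom_pos[OF gd] .
  have Yt: "Y t = exp t / (A + B * exp (2 * t))" for t
  proof -
    have "1 / Y t + Q t / (Y t)\<^sup>2 = 2 * A * exp (-t)" using E1[of t] by (simp add: exp_minus field_simps)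
    moreover have "1 / Y t - Q t / (Y t)\<^sup>2 = 2 * B * exp t" using E2[of t] by (simp add: exp_minus field_simps)
    ultimately have "1 / Y t = A * exp (-t) + B * exp t" by simp
    then have "exp t / Y t = A + B * exp (2 * t)"
      unfolding exp_double_real using Yne[of t] by (simp add: exp_minus field_simps power2_eq_square)
    then show ?thesis using Ypos[of t] pos[of t] by (simp add: field_simps)
  qed
  have Xt: "Re (c t) = Re (geo (Re (c 0)) k A B t)" for t
  proof -
    have "((\<lambda>t. Re (geo (Re (c 0)) k A B t)) has_real_derivative P t) (at t)" for t
      using geo_deriv[OF gd, of "Re (c 0)" t]
      unfolding has_vector_derivative_complex_iff has_real_derivative_iff_has_vector_derivative
      by (simp add: geo_velocity_def Pk Yt mult.commute)
    then have "((\<lambda>t. Re (c t) - Re (geo (Re (c 0)) k A B t)) has_real_derivative 0) (at t)" for t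
      using DERIV_diff[OF dX] by fastforce
    then have "Re (c t) - Re (geo (Re (c 0)) k A B t) = Re (c 0) - Re (geo (Re (c 0)) k A B 0)"
      by (rule DERIV_isconst_all[rule_format])
    then show ?thesis by (simp add: geo_def)
  qed
  show "c = geo (Re (c 0)) k A B"
  proof
    fix t show "c t = geo (Re (c 0)) k A B t"
      using Xt[of t] Yt[of t] by (simp add: complex_eq_iff Y_def geo_def)
  qed
qed

text \<open>
  A real limit forces \<open>B > 0\<close>, and then \<open>c\<close> differs from \<open>x + \<i> e\<^sup>-\<^sup>t / B\<close> by \<open>O(e\<^sup>-\<^sup>2\<^sup>t)\<close>, which is
  small against the height.  The constant \<open>1 / 10\<close> is what \<open>cusp_height_compare\<close> asks for.
\<close>

lemma cusp_asymptotics: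
  assumes c: "hyp_geodesic c" and lim: "(c \<longlongrightarrow> complex_of_real x) at_top"
  obtains r where "r > 0"
    "\<forall>\<^sub>F t in at_top. norm (c t - Complex x (r * exp (- t))) \<le> r * exp (- t) / 10"
proof -
  obtain x0 k A B where gd: "geo_data k A B" and ceq: "c = geo x0 k A B"
    using hyp_geodesic_eq_geo[OF c] by blast
  have AB: "A \<ge> 0" "B \<ge> 0" using gd by (auto simp: geo_data_def)
  have B: "B > 0"
  proof (rule ccontr)
    assume "\<not> B > 0"
    with AB have "B = 0" by simp
    then have A: "A > 0" using gd by (simp add: geo_data_def)
    have "((\<lambda>t. Im (c t)) \<longlongrightarrow> 0) at_top" using tendsto_Im[OF lim] by simp
    then have "\<forall>\<^sub>F t in at_top. Im (c t) < 1 / A" using A by (intro order_tendstoD) auto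
    moreover have "\<forall>\<^sub>F t in at_top. t \<ge> (0::real)" by (rule eventually_ge_at_top)
    ultimately have "\<forall>\<^sub>F t in at_top. Im (c t) < 1 / A \<and> t \<ge> 0" by (rule eventually_conj)
    then obtain t where t: "Im (c t) < 1 / A" "t \<ge> 0"
      using eventually_happens'[OF trivial_limit_at_top_linorder] by blast
    have "1 / A \<le> exp t / A" using t(2) A by (simp add: divide_right_mono)
    then show False using t(1) by (simp add: ceq geo_def \<open>B = 0\<close>)
  qed
  define x1 where "x1 = x0 + k / (2 * B * (A + B))"
  have pos: "A + B * exp (2 * t) > 0" "A + B > 0" for t
    using AB B by (auto intro: add_nonneg_pos)
  have re: "Re (c t) = x1 - k / (2 * B * (A + B * exp (2 * t)))" for t
  proof -
    have "k / 2 * (E - 1) / ((A + B) * (A + B * E)) = k / (2 * B * (A + B)) - k / (2 * B * (A + B * E))"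
      if "A + B * E > 0" for E
      using that pos(2) B by (simp add: divide_simps) (simp add: algebra_simps)
    from this[OF pos(1)[of t]] show ?thesis by (simp add: ceq geo_def x1_def)
  qed
  have im: "Im (c t) - exp (- t) / B = - (A * exp (- t) / (B * (A + B * exp (2 * t))))" for t
    using pos(1)[of t] B unfolding ceq geo_def complex.sel exp_double_real
    by (simp add: exp_minus divide_simps) (simp add: algebra_simps power2_eq_square)
  have large: "A + B * exp (2 * t) \<ge> B * exp t * exp t" for t
    using AB by (simp add: exp_double_real power2_eq_square)
  have e0: "((\<lambda>t::real. exp (- t)) \<longlongrightarrow> 0) at_top"
    by (intro filterlim_compose[OF exp_at_bot] filterlim_uminus_at_bot_at_top)
  have inv: "1 / (A + B * exp (2 * t)) \<le> exp (- t) * exp (- t) / B" for t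
  proof -
    have "1 / (A + B * exp (2 * t)) \<le> 1 / (B * exp t * exp t)"
      using large[of t] B by (intro divide_left_mono) (auto intro!: mult_pos_pos pos)
    then show ?thesis by (simp add: exp_minus field_simps)
  qed
  have Re_le: "\<bar>Re (c t) - x1\<bar> \<le> (exp (- t) / B) * (\<bar>k\<bar> / (2 * B) * exp (- t))" for t
  proof -
    have "\<bar>Re (c t) - x1\<bar> = \<bar>k\<bar> / (2 * B) * (1 / (A + B * exp (2 * t)))"
      using pos(1)[of t] B by (simp add: re abs_mult)
    also have "\<dots> \<le> \<bar>k\<bar> / (2 * B) * (exp (- t) * exp (- t) / B)"
      using inv[of t] B by (intro mult_left_mono) auto
    finally show ?thesis by (simp add: algebra_simps)
  qed
  have Im_le: "\<bar>Im (c t) - exp (- t) / B\<bar> \<le> (exp (- t) / B) * (A / B * exp (- t) * exp (- t))" for t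
  proof -
    have "\<bar>Im (c t) - exp (- t) / B\<bar> = (exp (- t) / B) * A * (1 / (A + B * exp (2 * t)))"
      using pos(1)[of t] AB B unfolding im by (simp add: abs_mult)
    also have "\<dots> \<le> (exp (- t) / B) * A * (exp (- t) * exp (- t) / B)"
      using inv[of t] AB B by (intro mult_left_mono) auto
    finally show ?thesis by (simp add: algebra_simps)
  qed
  have "((\<lambda>t. (exp (- t) / B) * (\<bar>k\<bar> / (2 * B) * exp (- t))) \<longlongrightarrow> (0 / B) * (\<bar>k\<bar> / (2 * B) * 0)) at_top"
    by (intro tendsto_intros e0) (use B in auto)
  then have "((\<lambda>t. (exp (- t) / B) * (\<bar>k\<bar> / (2 * B) * exp (- t))) \<longlongrightarrow> 0) at_top"
    by (rule tendsto_eq_rhs) simp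
  then have "((\<lambda>t. Re (c t) - x1) \<longlongrightarrow> 0) at_top"
    by (rule Lim_null_comparison[rotated]) (simp only: real_norm_def Re_le eventually_True)
  then have "((\<lambda>t. Re (c t)) \<longlongrightarrow> x1) at_top" by (rule LIM_zero_cancel)
  moreover have "((\<lambda>t. Re (c t)) \<longlongrightarrow> x) at_top" using tendsto_Re[OF lim] by simp
  ultimately have x1: "x1 = x" using tendsto_unique trivial_limit_at_top_linorder by blast
  have "((\<lambda>t. \<bar>k\<bar> / (2 * B) * exp (- t) + A / B * exp (- t) * exp (- t)) \<longlongrightarrow>
      \<bar>k\<bar> / (2 * B) * 0 + A / B * 0 * 0) at_top"
    by (intro tendsto_intros e0)
  then have "\<forall>\<^sub>F t in at_top. \<bar>k\<bar> / (2 * B) * exp (- t) + A / B * exp (- t) * exp (- t) < 1 / 10"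
    by (intro order_tendstoD) auto
  then have "\<forall>\<^sub>F t in at_top. norm (c t - Complex x (1 / B * exp (- t))) \<le> 1 / B * exp (- t) / 10"
  proof eventually_elim
    case (elim t)
    have "norm (c t - Complex x (1 / B * exp (- t))) \<le> \<bar>Re (c t) - x1\<bar> + \<bar>Im (c t) - exp (- t) / B\<bar>"
      using cmod_le[of "c t - Complex x (1 / B * exp (- t))"] by (simp add: x1)
    also have "\<dots> \<le> (exp (- t) / B) * (\<bar>k\<bar> / (2 * B) * exp (- t) + A / B * exp (- t) * exp (- t))"
      using Re_le[of t] Im_le[of t] by (simp add: distrib_left)
    also have "\<dots> \<le> (exp (- t) / B) * (1 / 10)" using elim B by (intro mult_left_mono) auto
    finally show ?case by simp
  qed
  then show ?thesis using B by (intro that[of "1 / B"]) auto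
qed

lemma hyp_geodesic_velocity_T1H:
  assumes "hyp_geodesic c" shows "velocity c t \<in> T1H"
  using assms unfolding hyp_geodesic_def velocity_def by (metis vector_derivative_at)

lemma hyp_geodesic_unique:
  assumes "hyp_geodesic c" "hyp_geodesic d" "velocity c 0 = velocity d 0"
  shows "c = d"
proof -
  have "c 0 = d 0" using assms(3) by (simp add: velocity_def)
  then show ?thesis
    using hyp_geodesic_eq_geo(2)[OF assms(1)] hyp_geodesic_eq_geo(2)[OF assms(2)] assms(3) by simp
qed

lemma hyp_geodesic_exists:
  assumes "u \<in> T1H" shows "\<exists>c. hyp_geodesic c \<and> velocity c 0 = u"
proof -
  obtain z w where u: "u = (z, w)" by (cases u)
  define y where "y = Im z"
  define k A B where "k = Re w / y\<^sup>2" and "A = (1 / y + Im w / y\<^sup>2) / 2" and "B = (1 / y - Im w / y\<^sup>2) / 2"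
  have y: "y > 0" "norm w = y" using assms by (auto simp: u T1H_def hyp_norm_def y_def)
  have gd: "geo_data k A B" unfolding k_def A_def B_def by (rule geo_data_of_tvec) fact+
  have AB: "A + B = 1 / y" by (simp add: A_def B_def field_simps)
  have "geo (Re z) k A B 0 = z" by (simp add: geo_def AB complex_eq_iff y_def)
  moreover have "geo_velocity k A B 0 = w"
  proof -
    have "A - B = Im w / y\<^sup>2" by (simp add: A_def B_def field_simps)
    then show ?thesis using y by (simp add: geo_velocity_def AB complex_eq_iff k_def)
  qed
  ultimately have "velocity (geo (Re z) k A B) 0 = u"
    using vector_derivative_at[OF geo_deriv[OF gd, of "Re z" 0]] by (simp add: velocity_def u)
  then show ?thesis using geo_hyp_geodesic[OF gd] by blast
qed

lemma hyp_geodesic_shift: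
  assumes "hyp_geodesic c"
  shows "hyp_geodesic (\<lambda>t. c (s + t))" "velocity (\<lambda>t. c (s + t)) t = velocity c (s + t)"
proof -
  obtain c' c'' where c: "\<And>t. (c has_vector_derivative c' t) (at t)"
     "\<And>t. (c' has_vector_derivative c'' t) (at t)"  "\<And>t. (c t, c' t) \<in> T1H"
     "\<And>t. c'' t = - (\<i> / complex_of_real (Im (c t))) * (c' t)\<^sup>2"
    using assms unfolding hyp_geodesic_def by metis
  have sh: "((\<lambda>t. f (s + t)) has_vector_derivative f') (at t)"
    if "(f has_vector_derivative f') (at (s + t))" for f :: "real \<Rightarrow> complex" and f' t
  proof -
    have "((+) s has_vector_derivative 1) (at t)"
      by (auto intro!: derivative_eq_intros)
    from vector_diff_chain_at[OF this that] show ?thesis by (simp add: o_def)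
  qed
  show "hyp_geodesic (\<lambda>t. c (s + t))" unfolding hyp_geodesic_def
    by (rule exI[of _ "\<lambda>t. c' (s + t)"], rule exI[of _ "\<lambda>t. c'' (s + t)"]) (use c sh in blast)
  show "velocity (\<lambda>t. c (s + t)) t = velocity c (s + t)"
    using vector_derivative_at[OF sh[OF c(1)]] vector_derivative_at[OF c(1)]
    by (simp add: velocity_def)
qed

lemma flowH_velocity:
  assumes "hyp_geodesic c" shows "flowH t (velocity c s) = velocity c (s + t)"
  unfolding flowH_def
proof (rule the_equality)
  show "\<exists>d. hyp_geodesic d \<and> velocity d 0 = velocity c s \<and> velocity d t = velocity c (s + t)"
    using hyp_geodesic_shift[OF assms, of s] by (metis add.right_neutral)
next
  fix u' assume "\<exists>d. hyp_geodesic d \<and> velocity d 0 = velocity c s \<and> velocity d t = u'"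
  then obtain d where d: "hyp_geodesic d" "velocity d 0 = velocity c s" "velocity d t = u'" by blast
  then have "d = (\<lambda>t. c (s + t))"
    using hyp_geodesic_shift[OF assms, of s] by (intro hyp_geodesic_unique) auto
  then show "u' = velocity c (s + t)" using d hyp_geodesic_shift(2)[OF assms] by simp
qed

section \<open>The geodesic flow of the modular surface\<close>

lemma moebius_denom_nonzero:
  fixes A :: "int^2^2"
  assumes "det A = (1::int)" "Im z > 0"
  shows "of_int (A$2$1) * z + of_int (A$2$2) \<noteq> (0 :: complex)"
proof
  assume *: "of_int (A$2$1) * z + of_int (A$2$2) = (0 :: complex)"
  then have "of_int (A$2$1) * Im z = 0" by (simp add: complex_eq_iff)
  then have "A$2$1 = 0" using assms(2) by simp
  moreover from this * have "A$2$2 = 0" by simp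
  ultimately show False using assms(1) by (simp add: det_2)
qed

lemma Im_moebius:
  assumes "det A = (1::int)" "Im z > 0"
  shows "Im (fst (moebius_tvec A (z, w))) = Im z / (norm (of_int (A$2$1) * z + of_int (A$2$2)))\<^sup>2"
proof -
  define p q r s :: real where "p = of_int (A$1$1)" and "q = of_int (A$1$2)"
    and "r = of_int (A$2$1)" and "s = of_int (A$2$2)"
  have d: "p * s - q * r = 1"
    using arg_cong[OF assms(1), of real_of_int] by (simp add: det_2 p_def q_def r_def s_def)
  have "Im ((of_real p * z + of_real q) / (of_real r * z + of_real s)) =
      (p * Im z * (r * Re z + s) - (p * Re z + q) * (r * Im z)) / (norm (of_real r * z + of_real s))\<^sup>2"
    by (simp add: Im_divide cmod_power2)
  also have "p * Im z * (r * Re z + s) - (p * Re z + q) * (r * Im z) = Im z * (p * s - q * r)"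
    by algebra
  finally show ?thesis
    unfolding d by (simp add: moebius_tvec_def p_def q_def r_def s_def)
qed

lemma moebius_T1H:
  assumes "det A = (1::int)" "u \<in> T1H"
  shows "moebius_tvec A u \<in> T1H"
proof -
  obtain z w where u: "u = (z, w)" by (cases u)
  define m :: complex where "m = of_int (A$2$1) * z + of_int (A$2$2)"
  have z: "Im z > 0" "norm w = Im z" using assms by (auto simp: u T1H_def hyp_norm_def)
  have m: "m \<noteq> 0" unfolding m_def by (rule moebius_denom_nonzero) fact+
  have im: "Im (fst (moebius_tvec A u)) = Im z / (norm m)\<^sup>2"
    unfolding u m_def by (rule Im_moebius) fact+
  have "norm (snd (moebius_tvec A u)) = Im z / (norm m)\<^sup>2"
    by (simp add: u moebius_tvec_def m_def[symmetric] norm_divide norm_power z)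
  then show ?thesis using im z m by (simp add: T1H_def hyp_norm_def)
qed

text \<open>
  This is the cocycle property of the denominators \<open>r z + s\<close>: they multiply under composition, and so
  do their inverse squares, which are the derivatives.
\<close>

lemma moebius_mult:
  assumes "det B = (1::int)" "det A = 1" "u \<in> T1H"
  shows "moebius_tvec A (moebius_tvec B u) = moebius_tvec (A ** B) u"
proof -
  obtain z w where u: "u = (z, w)" by (cases u)
  have z: "Im z > 0" using assms by (auto simp: u T1H_def)
  define m :: complex where "m = of_int (B$2$1) * z + of_int (B$2$2)"
  have m: "m \<noteq> 0" unfolding m_def by (rule moebius_denom_nonzero) fact+
  have 1: "of_int ((A ** B)$2$1) * z + of_int ((A ** B)$2$2) =
     of_int (A$2$1) * (of_int (B$1$1) * z + of_int (B$1$2)) + of_int (A$2$2) * m"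
    "of_int ((A ** B)$1$1) * z + of_int ((A ** B)$1$2) =
     of_int (A$1$1) * (of_int (B$1$1) * z + of_int (B$1$2)) + of_int (A$1$2) * m"
    by (simp_all add: matrix_matrix_mult_def sum_2 m_def algebra_simps)
  have 2: "of_int (A$i$1) * (p / m) + of_int (A$i$2) = (of_int (A$i$1) * p + of_int (A$i$2) * m) / m" for i and p :: complex
    using m by (simp add: field_simps)
  show ?thesis unfolding u moebius_tvec_def fst_conv snd_conv 1 m_def[symmetric] 2
    using m by (simp add: power_divide)
qed

lemma moebius_id: "moebius_tvec (mat 1) u = u"
  by (simp add: moebius_tvec_def mat_def)

lemma PSL2Z_equiv: "equiv T1H PSL2Z_rel"
proof (rule equivI)
  show "PSL2Z_rel \<subseteq> T1H \<times> T1H" using moebius_T1H by (auto simp: PSL2Z_rel_def)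
  show "refl_on T1H PSL2Z_rel" unfolding refl_on_def PSL2Z_rel_def
    by (auto intro!: exI[of _ "mat 1"] simp: moebius_id)
  show "sym PSL2Z_rel"
  proof (rule symI)
    fix u u' assume "(u, u') \<in> PSL2Z_rel"
    then obtain A where A: "u \<in> T1H" "det A = 1" "u' = moebius_tvec A u" by (auto simp: PSL2Z_rel_def)
    define B :: "int^2^2" where "B = vector [vector [A$2$2, - A$1$2], vector [- A$2$1, A$1$1]]"
    have B: "det B = 1" using A(2) by (simp add: B_def det_2 algebra_simps)
    have "B ** A = mat 1" using A(2)
      by (simp add: B_def det_2 vec_eq_iff matrix_matrix_mult_def sum_2 forall_2 mat_def algebra_simps)
    then have "moebius_tvec B u' = u" unfolding A(3) moebius_mult[OF A(2) B A(1)] by (simp add: moebius_id)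
    then show "(u', u) \<in> PSL2Z_rel" using moebius_T1H[OF A(2,1)] A(3) B by (auto simp: PSL2Z_rel_def)
  qed
  show "trans PSL2Z_rel"
  proof (rule transI)
    fix u v w assume "(u, v) \<in> PSL2Z_rel" "(v, w) \<in> PSL2Z_rel"
    then obtain A B where A: "u \<in> T1H" "det A = 1" "v = moebius_tvec A u" "det B = 1" "w = moebius_tvec B v"
      by (auto simp: PSL2Z_rel_def)
    then have "w = moebius_tvec (B ** A) u" "det (B ** A) = 1" by (simp_all add: moebius_mult det_mul)
    then show "(u, w) \<in> PSL2Z_rel" using A(1) by (auto simp: PSL2Z_rel_def)
  qed
qed

text \<open>
  Isometries map geodesics to geodesics.  In the geodesic equation the second derivative of the
  Moebius transformation contributes \<open>- 2 r c'\<^sup>2 / m\<^sup>3\<close> with \<open>m = r c + s\<close>, and this is what turns \<open>m\<close>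
  into its conjugate in the coefficient \<open>\<i> / Im c\<close>.
\<close>

lemma hyp_geodesic_moebius:
  assumes "hyp_geodesic c" "det A = (1::int)"
  shows "hyp_geodesic (\<lambda>t. fst (moebius_tvec A (velocity c t)))" (is "hyp_geodesic ?g")
    and "velocity (\<lambda>t. fst (moebius_tvec A (velocity c t))) t = moebius_tvec A (velocity c t)"
proof -
  obtain c' c'' where c: "\<And>t. (c has_vector_derivative c' t) (at t)"
     "\<And>t. (c' has_vector_derivative c'' t) (at t)"  "\<And>t. (c t, c' t) \<in> T1H"
     "\<And>t. c'' t = - (\<i> / complex_of_real (Im (c t))) * (c' t)\<^sup>2"
    using assms unfolding hyp_geodesic_def by metis
  have vel: "velocity c t = (c t, c' t)" for t
    using vector_derivative_at[OF c(1)] by (simp add: velocity_def)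
  define p q r s :: complex where "p = of_int (A$1$1)" and "q = of_int (A$1$2)"
    and "r = of_int (A$2$1)" and "s = of_int (A$2$2)"
  have det: "p * s - q * r = 1"
    using arg_cong[OF assms(2), of complex_of_int] by (simp add: det_2 p_def q_def r_def s_def)
  define m where "m t = r * c t + s" for t
  have ypos: "Im (c t) > 0" for t using c(3)[of t] by (simp add: T1H_def)
  have m: "m t \<noteq> 0" for t unfolding m_def r_def s_def by (rule moebius_denom_nonzero) fact+
  have g: "?g t = (p * c t + q) / m t" for t
    by (simp add: vel moebius_tvec_def p_def q_def r_def s_def m_def)
  have dm: "(m has_vector_derivative r * c' t) (at t)" for t
    unfolding m_def[abs_def] by (auto intro!: derivative_eq_intros c)
  have dinv: "((\<lambda>t. 1 / m t) has_vector_derivative - (r * c' t) / (m t)\<^sup>2) (at t)" for t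
  proof -
    have "((\<lambda>z. 1 / z) has_field_derivative - 1 / (m t)\<^sup>2) (at (m t))"
      using m[of t] by (auto intro!: derivative_eq_intros simp: power2_eq_square)
    from field_vector_diff_chain_at[OF dm this]
    have "((\<lambda>t. 1 / m t) has_vector_derivative r * c' t * (- 1 / (m t)\<^sup>2)) (at t)"
      by (simp only: o_def)
    also have "r * c' t * (- 1 / (m t)\<^sup>2) = - (r * c' t) / (m t)\<^sup>2" by simp
    finally show ?thesis .
  qed
  have dg: "(?g has_vector_derivative c' t / (m t)\<^sup>2) (at t)" for t
  proof -
    have "((\<lambda>t. (p * c t + q) * (1 / m t)) has_vector_derivative
        (p * c t + q) * (- (r * c' t) / (m t)\<^sup>2) + p * c' t * (1 / m t)) (at t)"
      by (intro has_vector_derivative_mult dinv) (auto intro!: derivative_eq_intros c)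
    moreover have "(p * c t + q) * (- (r * c' t) / (m t)\<^sup>2) + p * c' t * (1 / m t) =
        c' t * (p * m t - r * (p * c t + q)) / (m t)\<^sup>2"
      using m[of t] by (simp add: field_simps power2_eq_square)
    moreover have "p * m t - r * (p * c t + q) = 1" using det by (simp add: m_def algebra_simps)
    ultimately show ?thesis by (simp add: g[abs_def])
  qed
  define g'' where "g'' t = c'' t / (m t)\<^sup>2 - 2 * r * (c' t)\<^sup>2 / (m t)^3" for t
  have dg': "((\<lambda>t. c' t / (m t)\<^sup>2) has_vector_derivative g'' t) (at t)" for t
  proof -
    have "((\<lambda>t. c' t * ((1 / m t) * (1 / m t))) has_vector_derivative
        c' t * ((1 / m t) * (- (r * c' t) / (m t)\<^sup>2) + (- (r * c' t) / (m t)\<^sup>2) * (1 / m t)) +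
        c'' t * ((1 / m t) * (1 / m t))) (at t)"
      by (intro has_vector_derivative_mult c dinv)
    moreover have "c' t * ((1 / m t) * (- (r * c' t) / (m t)\<^sup>2) + (- (r * c' t) / (m t)\<^sup>2) * (1 / m t)) +
        c'' t * ((1 / m t) * (1 / m t)) = g'' t"
      using m[of t] by (simp add: g''_def field_simps power2_eq_square power3_eq_cube)
    moreover have "(\<lambda>t. c' t * ((1 / m t) * (1 / m t))) = (\<lambda>t. c' t / (m t)\<^sup>2)"
      by (simp add: power2_eq_square)
    ultimately show ?thesis by simp
  qed
  have T1: "moebius_tvec A (c t, c' t) = (?g t, c' t / (m t)\<^sup>2)" for t
    by (simp add: vel moebius_tvec_def r_def s_def m_def)
  have T1H: "(?g t, c' t / (m t)\<^sup>2) \<in> T1H" for t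
    unfolding T1[symmetric] by (rule moebius_T1H) fact+
  have ode: "g'' t = - (\<i> / complex_of_real (Im (?g t))) * (c' t / (m t)\<^sup>2)\<^sup>2" for t
  proof -
    define y where "y = complex_of_real (Im (c t))"
    have y: "y \<noteq> 0" using ypos[of t] by (simp add: y_def)
    have im: "complex_of_real (Im (?g t)) = y / (m t * cnj (m t))"
    proof -
      have "Im (?g t) = Im (c t) / (norm (m t))\<^sup>2"
        unfolding vel m_def r_def s_def by (rule Im_moebius) fact+
      then show ?thesis by (simp add: y_def complex_norm_square[symmetric])
    qed
    have "cnj (m t) = m t - 2 * \<i> * r * y"
      by (simp add: m_def complex_eq_iff r_def s_def y_def)
    moreover have "- \<i> * M - 2 * r * y = - \<i> * C" if "C = M - 2 * \<i> * r * y" for M C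
      unfolding that by (simp add: algebra_simps)
    ultimately have key: "- \<i> * m t - 2 * r * y = - \<i> * cnj (m t)" by blast
    have alg: "- (\<i> / y) * u\<^sup>2 / M\<^sup>2 - 2 * r * u\<^sup>2 / M ^ 3 = u\<^sup>2 / (M ^ 3 * y) * (- \<i> * M - 2 * r * y)"
      "- (\<i> / (y / (M * C))) * (u / M\<^sup>2)\<^sup>2 = u\<^sup>2 / (M ^ 3 * y) * (- \<i> * C)"
      if "M \<noteq> 0" for u M C :: complex
      using y that by (simp_all add: divide_simps power2_eq_square power3_eq_cube) (simp add: algebra_simps)
    have "g'' t = - (\<i> / y) * (c' t)\<^sup>2 / (m t)\<^sup>2 - 2 * r * (c' t)\<^sup>2 / (m t) ^ 3"
      by (simp add: g''_def c(4) y_def)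
    also have "\<dots> = (c' t)\<^sup>2 / ((m t) ^ 3 * y) * (- \<i> * m t - 2 * r * y)"
      by (rule alg(1)[OF m])
    also have "\<dots> = - (\<i> / (y / (m t * cnj (m t)))) * (c' t / (m t)\<^sup>2)\<^sup>2"
      unfolding key by (rule alg(2)[OF m, symmetric])
    finally show ?thesis unfolding im .
  qed
  show "hyp_geodesic ?g" unfolding hyp_geodesic_def
    by (rule exI[of _ "\<lambda>t. c' t / (m t)\<^sup>2"], rule exI[of _ g'']) (intro allI conjI dg dg' T1H ode)
  show "velocity ?g t = moebius_tvec A (velocity c t)"
  proof -
    have "velocity ?g t = (?g t, c' t / (m t)\<^sup>2)"
      by (simp only: velocity_def[of ?g] vector_derivative_at[OF dg])
    also have "\<dots> = moebius_tvec A (velocity c t)" using T1[of t] unfolding vel by (rule sym)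
    finally show ?thesis .
  qed
qed

lemma proj_eq_iff: "u \<in> T1H \<Longrightarrow> u' \<in> T1H \<Longrightarrow> proj u = proj u' \<longleftrightarrow> (u, u') \<in> PSL2Z_rel"
  unfolding proj_def by (rule eq_equiv_class_iff[OF PSL2Z_equiv])

text \<open>
  The flow commutes with \<open>PSL(2,\<int>)\<close>, so it moves the whole class along one geodesic.
\<close>

lemma flowM_proj_velocity:
  assumes "hyp_geodesic c"
  shows "flowM t (proj (velocity c s)) = proj (velocity c (s + t))"
proof -
  have "flowH t (moebius_tvec A (velocity c s)) = moebius_tvec A (velocity c (s + t))"
    if "det A = 1" for A
    using flowH_velocity[OF hyp_geodesic_moebius(1)[OF assms that], of t s]
    by (simp add: hyp_geodesic_moebius(2)[OF assms that])
  moreover have "proj (velocity c s) = {moebius_tvec A (velocity c s) |A. det A = 1}" for s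
    using hyp_geodesic_velocity_T1H[OF assms] by (auto simp: proj_def PSL2Z_rel_def)
  moreover have "f ` {g A |A. P A} = {h A |A. P A}"
    if "\<And>A. P A \<Longrightarrow> f (g A) = h A" for f :: "tvec \<Rightarrow> tvec" and g h and P :: "int^2^2 \<Rightarrow> bool"
    using that by force
  ultimately show ?thesis by (simp add: flowM_def)
qed

text \<open>
  A lift passes through some vector over \<open>v\<close>, but not necessarily at time 0: hence the shift \<open>s\<close>.
\<close>

lemma lift_flow:
  assumes "is_lift c v" "v \<in> T1M"
  shows "\<exists>s. \<forall>t. flowM t v = proj (velocity c (s + t))"
proof -
  obtain u where u: "u \<in> T1H" "v = proj u" using assms(2) by (auto simp: T1M_def quotient_def proj_def)
  obtain d where d: "hyp_geodesic d" "velocity d 0 = u" using hyp_geodesic_exists[OF u(1)] by blast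
  have "flowM 0 v = v" using flowM_proj_velocity[OF d(1), of 0 0] d u by simp
  moreover have "flowM 0 v \<in> proj ` range (velocity c)" using assms(1) by (auto simp: is_lift_def)
  ultimately obtain s where "v = proj (velocity c s)" by auto
  then show ?thesis using flowM_proj_velocity[of c] assms(1) by (auto simp: is_lift_def)
qed

section \<open>Heights over the cusps\<close>

text \<open>
  The imaginary part of \<open>g z\<close> for any \<open>g\<close> in \<open>PSL(2,\<int>)\<close> with lower row \<open>(m, n)\<close>: the height of \<open>z\<close>
  over the cusp \<open>- n / m\<close>.
\<close>

definition cusp_height :: "int \<Rightarrow> int \<Rightarrow> complex \<Rightarrow> real" where
  "cusp_height m n z = Im z / (norm (of_int m * z + of_int n))\<^sup>2"

definition high_points :: "real \<Rightarrow> complex set" where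
  "high_points d = {z. Im z > 0 \<and> (\<exists>m n. coprime m n \<and> cusp_height m n z > d)}"

lemma proj_in_cuspM_iff:
  assumes "u \<in> T1H"
  shows "proj u \<in> cuspM d \<longleftrightarrow> fst u \<in> high_points d"
proof
  have im: "Im (fst u) > 0" using assms by (simp add: T1H_def)
  {
    assume "proj u \<in> cuspM d"
    then obtain u' where u': "u' \<in> T1H" "Im (fst u') > d" "proj u = proj u'"
      by (auto simp: cuspM_def cuspH_def)
    then obtain A where A: "det A = 1" "u' = moebius_tvec A u"
      using proj_eq_iff[OF assms u'(1)] by (auto simp: PSL2Z_rel_def)
    have "coprime (A$2$1) (A$2$2)"
    proof (rule coprimeI)
      fix l assume "l dvd A$2$1" "l dvd A$2$2"
      then have "l dvd det A" by (simp add: det_2)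
      then show "is_unit l" using A(1) by simp
    qed
    moreover have "cusp_height (A$2$1) (A$2$2) (fst u) > d"
      using Im_moebius[OF A(1) im, of "snd u"] u'(2) A(2) by (simp add: cusp_height_def)
    ultimately show "fst u \<in> high_points d" using im by (auto simp: high_points_def)
  next
    assume "fst u \<in> high_points d"
    then obtain m n where mn: "coprime m n" "cusp_height m n (fst u) > d" by (auto simp: high_points_def)
    obtain p q where pq: "p * m + q * n = 1"
      using bezout_int[of m n] mn(1) by auto
    define A :: "int^2^2" where "A = vector [vector [q, - p], vector [m, n]]"
    have A: "det A = 1" using pq by (simp add: A_def det_2 algebra_simps)
    define u' where "u' = moebius_tvec A u"
    have "u' \<in> T1H" unfolding u'_def by (rule moebius_T1H[OF A assms])
    moreover have "Im (fst u') > d"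
      using Im_moebius[OF A im, of "snd u"] mn(2) by (simp add: cusp_height_def u'_def A_def)
    moreover have "(u, u') \<in> PSL2Z_rel" using assms A by (auto simp: PSL2Z_rel_def u'_def)
    ultimately show "proj u \<in> cuspM d" using proj_eq_iff[OF assms, of u'] 
      by (auto simp: cuspM_def cuspH_def)
  }
qed

text \<open>
  Disjointness of horoballs: for different cusps the determinant \<open>m n' - m' n\<close> is a nonzero integer,
  and it equals, up to the factor \<open>Im z\<close>, the imaginary part of \<open>(m z + n)\<close> times the conjugate of
  \<open>m' z + n'\<close>.
\<close>

lemma cusp_heights_exclusive:
  assumes "coprime m n" "coprime m' n'" "Im z > 0"
  shows "cusp_height m n z = cusp_height m' n' z \<or> cusp_height m n z * cusp_height m' n' z \<le> 1"
proof (cases "m * n' = m' * n")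
  case True
  have "\<bar>m\<bar> * \<bar>n'\<bar> = \<bar>m'\<bar> * \<bar>n\<bar>" using True by (simp flip: abs_mult)
  then have "\<bar>m\<bar> = \<bar>m'\<bar> \<and> \<bar>n'\<bar> = \<bar>n\<bar>"
    using coprime_crossproduct_int[OF assms(1,2)] by blast
  then have eq: "\<bar>m\<bar> = \<bar>m'\<bar>" "\<bar>n\<bar> = \<bar>n'\<bar>" by simp_all
  have "norm (of_int m * z + of_int n) = norm (of_int m' * z + of_int n')"
  proof (cases "m = 0")
    case True
    have "\<bar>real_of_int n\<bar> = \<bar>real_of_int n'\<bar>" using arg_cong[OF eq(2), of real_of_int] by simp
    then show ?thesis using True eq(1) by simp
  next
    case False
    have "of_int m' * (of_int m * z + of_int n) = (of_int m * (of_int m' * z + of_int n') :: complex)"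
      using arg_cong[OF True, of complex_of_int] by (simp add: algebra_simps)
    from arg_cong[OF this, of norm]
    have "\<bar>real_of_int m'\<bar> * norm (of_int m * z + of_int n) = \<bar>real_of_int m\<bar> * norm (of_int m' * z + of_int n')"
      by (simp add: norm_mult)
    moreover have "\<bar>real_of_int m'\<bar> = \<bar>real_of_int m\<bar>" "\<bar>real_of_int m\<bar> \<noteq> 0"
      using False arg_cong[OF eq(1), of real_of_int] by simp_all
    ultimately show ?thesis by simp
  qed
  then show ?thesis by (simp add: cusp_height_def)
next
  case False
  define u v where "u = of_int m * z + of_int n" and "v = of_int m' * z + of_int n'"
  have "Im (u * cnj v) = real_of_int (m * n' - m' * n) * Im z"
    by (simp add: u_def v_def algebra_simps)
  moreover have "\<bar>real_of_int (m * n' - m' * n)\<bar> \<ge> 1" using False by linarith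
  ultimately have "Im z \<le> \<bar>Im (u * cnj v)\<bar>"
    using assms(3) mult_right_mono[of 1 "\<bar>real_of_int (m * n' - m' * n)\<bar>" "Im z"] by (simp add: abs_mult)
  also have "\<dots> \<le> norm u * norm v" using abs_Im_le_cmod[of "u * cnj v"] by (simp add: norm_mult)
  finally have le: "Im z \<le> norm u * norm v" .
  then have "norm u * norm v > 0" using assms(3) by linarith
  moreover have "(Im z)\<^sup>2 \<le> (norm u * norm v)\<^sup>2" using le assms(3) by (intro power_mono) auto
  ultimately have "(Im z)\<^sup>2 / (norm u * norm v)\<^sup>2 \<le> 1" by (simp add: divide_le_eq)
  moreover have "cusp_height m n z * cusp_height m' n' z = (Im z)\<^sup>2 / (norm u * norm v)\<^sup>2"
    by (simp add: cusp_height_def u_def v_def power_mult_distrib power2_eq_square)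
  ultimately show ?thesis by simp
qed

lemma cusp_height_compare:
  assumes "Im z > 0" "norm (w - z) \<le> Im z / 10"
  shows "cusp_height m n w \<le> 2 * cusp_height m n z" "cusp_height m n z \<le> 2 * cusp_height m n w"
proof -
  define P Q where "P = norm (of_int m * w + of_int n)" and "Q = norm (of_int m * z + of_int n)"
  have "\<bar>Im w - Im z\<bar> \<le> Im z / 10" using abs_Im_le_cmod[of "w - z"] assms(2) by simp
  from abs_le_D1[OF this] abs_le_D2[OF this]
  have I: "9 / 10 * Im z \<le> Im w" "Im w \<le> 11 / 10 * Im z" by linarith+
  have "\<bar>P - Q\<bar> \<le> norm (of_int m * (w - z))"
    unfolding P_def Q_def using norm_triangle_ineq3[of "of_int m * w + of_int n" "of_int m * z + of_int n"]
    by (simp add: algebra_simps)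
  also have "\<dots> \<le> \<bar>real_of_int m\<bar> * (Im z / 10)"
    using assms(2) unfolding norm_mult norm_of_int by (intro mult_left_mono) auto
  also have "\<dots> \<le> Q / 10"
    using abs_Im_le_cmod[of "of_int m * z + of_int n"] assms(1) by (simp add: Q_def abs_mult)
  finally have "\<bar>P - Q\<bar> \<le> Q / 10" .
  from abs_le_D1[OF this] abs_le_D2[OF this]
  have P: "9 / 10 * Q \<le> P" "P \<le> 11 / 10 * Q" by linarith+
  have Q0: "Q \<ge> 0" by (simp add: Q_def)
  have "cusp_height m n w \<le> 2 * cusp_height m n z \<and> cusp_height m n z \<le> 2 * cusp_height m n w"
  proof (cases "Q = 0")
    case True
    then show ?thesis using P by (simp add: cusp_height_def P_def[symmetric] Q_def[symmetric])
  next
    case False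
    then have Q: "Q > 0" using Q0 by simp
    then have Ppos: "P > 0" using P(1) by linarith
    have P2: "(9 / 10 * Q)\<^sup>2 \<le> P\<^sup>2" "P\<^sup>2 \<le> (11 / 10 * Q)\<^sup>2"
      using P Q Ppos by (auto intro!: power_mono)
    have "Im w / P\<^sup>2 \<le> (11 / 10 * Im z) / (9 / 10 * Q)\<^sup>2"
      using I P2 assms(1) Q Ppos by (intro frac_le) auto
    also have "\<dots> \<le> 2 * (Im z / Q\<^sup>2)"
      using assms(1) Q by (simp add: power2_eq_square field_simps)
    finally have 1: "Im w / P\<^sup>2 \<le> 2 * (Im z / Q\<^sup>2)" .
    have "Im z / Q\<^sup>2 \<le> 2 * ((9 / 10 * Im z) / (11 / 10 * Q)\<^sup>2)"
      using assms(1) Q by (simp add: power2_eq_square field_simps)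
    also have "\<dots> \<le> 2 * (Im w / P\<^sup>2)"
      using I P2 assms(1) Q Ppos by (intro mult_left_mono frac_le) auto
    finally show ?thesis using 1 by (simp add: cusp_height_def P_def Q_def)
  qed
  then show "cusp_height m n w \<le> 2 * cusp_height m n z" "cusp_height m n z \<le> 2 * cusp_height m n w" by auto
qed

lemma open_high_points: "open (high_points d)"
proof -
  have "open {z. Im z > 0 \<and> cusp_height m n z > d}" if mn: "coprime m n" for m n
  proof -
    have ne: "of_int m * z + of_int n \<noteq> (0::complex)" if "Im z > 0" for z
    proof
      assume *: "of_int m * z + of_int n = (0::complex)"
      then have "of_int m * Im z = 0" by (simp add: complex_eq_iff)
      then have "m = 0" using that by simp
      moreover from this * have "n = 0" by simp
      ultimately show False using mn by simp
    qed
    have "continuous_on {z. Im z > 0} (cusp_height m n)"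
      unfolding cusp_height_def by (intro continuous_intros) (use ne in auto)
    then have "open ({z. Im z > 0} \<inter> cusp_height m n -` {d<..})"
      by (rule continuous_open_preimage) (auto intro: open_halfspace_Im_gt)
    moreover have "{z. Im z > 0} \<inter> cusp_height m n -` {d<..} = {z. Im z > 0 \<and> cusp_height m n z > d}" by auto
    ultimately show ?thesis by simp
  qed
  moreover have "high_points d = (\<Union>(m, n)\<in>{(m, n). coprime m n}. {z. Im z > 0 \<and> cusp_height m n z > d})"
    by (auto simp: high_points_def)
  ultimately show ?thesis by (auto intro!: open_UN)
qed

section \<open>Digits and remainders of (a,b)-continued fractions\<close>

declare cf_remainder.simps(2) [simp del]

text \<open>
  The expansion of one irrational number, with remainders \<open>X\<close> and digits \<open>D\<close>.
\<close>

locale ab_expansion =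
  fixes a b x :: real
  assumes params: "(a, b) \<in> params" and irrational: "x \<notin> \<rat>"
begin

abbreviation "X \<equiv> cf_remainder a b x"
abbreviation "D \<equiv> cf_quotient a b x"

definition "\<kappa> = min b (- a)"

lemma ab: "-1 \<le> a" "a < 0" "0 < b" "b \<le> 1" "b - a \<ge> 1"
  using params by (auto simp: params_def)

lemma \<kappa>_bounds: "0 < \<kappa>" "\<kappa> \<le> 1" "\<kappa> \<le> b" "\<kappa> \<le> - a"
  using ab by (auto simp: \<kappa>_def)

lemma X_Suc: "X (Suc j) = - 1 / (X j - D j)"
  by (simp add: cf_quotient_def cf_remainder.simps(2))

lemma X_irrational: "X j \<notin> \<rat>"
proof (induction j)
  case (Suc j)
  show ?case
  proof
    assume "X (Suc j) \<in> \<rat>"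
    then have "of_int (D j) - 1 / X (Suc j) \<in> \<rat>" by (intro Rats_diff Rats_divide) auto
    also have "of_int (D j) - 1 / X (Suc j) = X j" unfolding X_Suc by simp
    finally show False using Suc by simp
  qed
qed (simp add: irrational)

lemma X_ne_int: "X j \<noteq> of_int k" "\<bar>X j\<bar> \<noteq> 1" "X j \<noteq> 0"
  using X_irrational[of j] by (metis Rats_of_int, metis Rats_1 Rats_minus_iff abs_if, metis Rats_0)

lemma frac_bounds:
  "D j < 0 \<Longrightarrow> a \<le> X j - D j \<and> X j - D j < a + 1"
  "D j > 0 \<Longrightarrow> b - 1 \<le> X j - D j \<and> X j - D j < b"
  "a \<le> X j - D j \<and> X j - D j < b"
proof -
  have "(D j < 0 \<longrightarrow> a \<le> X j - D j \<and> X j - D j < a + 1) \<and>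
        (D j > 0 \<longrightarrow> b - 1 \<le> X j - D j \<and> X j - D j < b) \<and>
        (a \<le> X j - D j \<and> X j - D j < b)"
    using ab unfolding cf_quotient_def floor_ab_def by (auto split: if_splits; linarith)
  then show "D j < 0 \<Longrightarrow> a \<le> X j - D j \<and> X j - D j < a + 1"
    "D j > 0 \<Longrightarrow> b - 1 \<le> X j - D j \<and> X j - D j < b" "a \<le> X j - D j \<and> X j - D j < b"
    by auto
qed

lemma frac_nonzero: "X j - D j \<noteq> 0"
  using X_ne_int(1)[of j "D j"] by simp

lemma X_Suc_mult: "X (Suc j) * (X j - D j) = - 1"
  unfolding X_Suc using frac_nonzero[of j] by simp

lemma X_Suc_sign: "X (Suc j) > 0 \<longleftrightarrow> X j - D j < 0"
  unfolding X_Suc by (simp add: zero_less_divide_iff)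

lemma abs_X_gt_1: "\<bar>X (Suc j)\<bar> > 1"
proof -
  have "\<bar>X j - D j\<bar> \<le> 1" using frac_bounds(3)[of j] ab by linarith
  then have "\<bar>X (Suc j)\<bar> \<ge> 1" unfolding X_Suc using frac_nonzero[of j]
    by (simp add: abs_divide)
  then show ?thesis using X_ne_int(2)[of "Suc j"] by linarith
qed

lemma D_sign: "D (Suc j) > 0 \<longleftrightarrow> X (Suc j) > 0" "D (Suc j) < 0 \<longleftrightarrow> X (Suc j) < 0" "D (Suc j) \<noteq> 0"
proof -
  have "(X (Suc j) > 0 \<longrightarrow> D (Suc j) > 0) \<and> (X (Suc j) < 0 \<longrightarrow> D (Suc j) < 0)"
    using abs_X_gt_1[of j] ab unfolding cf_quotient_def floor_ab_def by auto
  then show "D (Suc j) > 0 \<longleftrightarrow> X (Suc j) > 0" "D (Suc j) < 0 \<longleftrightarrow> X (Suc j) < 0" "D (Suc j) \<noteq> 0"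
    using X_ne_int(3)[of "Suc j"] by linarith+
qed

text \<open>
  If both digits are positive, then \<open>X j - D j\<close> lies in \<open>[b - 1, 0)\<close>, which gives
  \<open>X (Suc j) \<ge> 1 / (1 - b)\<close>, and this exceeds \<open>1 + b\<close>; so the next digit cannot be 1.  The case of two negative
  digits is the mirror image, with \<open>- a\<close> in place of \<open>b\<close>.
\<close>

lemma same_sign:
  assumes "D j * D (Suc j) > 0"
  shows "\<bar>D (Suc j)\<bar> \<ge> 2" "\<kappa> * \<bar>X (Suc j)\<bar> \<le> \<bar>X (Suc j)\<bar> - 1"
proof -
  have "\<bar>D (Suc j)\<bar> \<ge> 2 \<and> \<kappa> * \<bar>X (Suc j)\<bar> \<le> \<bar>X (Suc j)\<bar> - 1"
  proof (cases "D (Suc j) > 0")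
    case True
    then have pos: "X (Suc j) > 0" "D j > 0" using D_sign assms by (auto simp: zero_less_mult_iff)
    have "- (X j - D j) \<le> 1 - b" using frac_bounds(2)[OF pos(2)] by simp
    then have "X (Suc j) * (- (X j - D j)) \<le> X (Suc j) * (1 - b)"
      using pos by (intro mult_left_mono) auto
    then have ge: "1 \<le> X (Suc j) * (1 - b)" using X_Suc_mult[of j] by (simp add: algebra_simps)
    have "D (Suc j) \<noteq> 1"
    proof
      assume "D (Suc j) = 1"
      then have "X (Suc j) < 1 + b" using frac_bounds(3)[of "Suc j"] by simp
      moreover have "1 - b \<ge> 0" using ab by simp
      ultimately have "X (Suc j) * (1 - b) \<le> (1 + b) * (1 - b)" by (intro mult_right_mono) auto
      also have "\<dots> < 1" using ab mult_neg_neg[of a a] mult_pos_pos[of b b] by (simp add: algebra_simps)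
      finally show False using ge by simp
    qed
    moreover have "\<kappa> * X (Suc j) \<le> X (Suc j) - 1"
    proof -
      have "\<kappa> * X (Suc j) \<le> b * X (Suc j)" using \<kappa>_bounds pos by (intro mult_right_mono) auto
      also have "\<dots> \<le> X (Suc j) - 1" using ge by (simp add: algebra_simps)
      finally show ?thesis .
    qed
    ultimately show ?thesis using True pos by simp
  next
    case False
    then have neg: "D (Suc j) < 0" "X (Suc j) < 0" "D j < 0"
      using D_sign(3)[of j] D_sign(2)[of j] assms by (auto simp: zero_less_mult_iff)
    have "X j - D j \<le> 1 + a" using frac_bounds(1)[OF neg(3)] by simp
    then have "(- X (Suc j)) * (X j - D j) \<le> (- X (Suc j)) * (1 + a)"
      using neg by (intro mult_left_mono) auto
    then have ge: "1 \<le> (- X (Suc j)) * (1 + a)" using X_Suc_mult[of j] by (simp add: algebra_simps)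
    have "D (Suc j) \<noteq> - 1"
    proof
      assume "D (Suc j) = - 1"
      then have "- X (Suc j) \<le> 1 - a" using frac_bounds(3)[of "Suc j"] by simp
      moreover have "1 + a \<ge> 0" using ab by simp
      ultimately have "(- X (Suc j)) * (1 + a) \<le> (1 - a) * (1 + a)" by (intro mult_right_mono) auto
      also have "\<dots> < 1" using ab mult_neg_neg[of a a] mult_pos_pos[of b b] by (simp add: algebra_simps)
      finally show False using ge by simp
    qed
    moreover have "\<kappa> * - X (Suc j) \<le> - X (Suc j) - 1"
    proof -
      have "\<kappa> * (- X (Suc j)) \<le> (- a) * (- X (Suc j))" using \<kappa>_bounds neg by (intro mult_right_mono) auto
      also have "\<dots> \<le> - X (Suc j) - 1" using ge by (simp add: algebra_simps)
      finally show ?thesis .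
    qed
    ultimately show ?thesis using neg by simp
  qed
  then show "\<bar>D (Suc j)\<bar> \<ge> 2" "\<kappa> * \<bar>X (Suc j)\<bar> \<le> \<bar>X (Suc j)\<bar> - 1" by auto
qed

text \<open>
  A single remainder may be arbitrarily close to \<open>\<plusminus>1\<close>, but not two consecutive ones: after a digit
  of the same sign a remainder is at least \<open>1 / (1 - \<kappa>)\<close> in absolute value, and if the sign changes, then
  \<open>X (Suc j)\<close> is a digit plus a fractional part of the same sign, while \<open>X (Suc (Suc j))\<close> is minus the inverse
  of that fractional part.
\<close>

lemma X_pair_growth: "1 + \<kappa> \<le> \<bar>X (Suc j)\<bar> * \<bar>X (Suc (Suc j))\<bar>"
proof (cases "D (Suc j) * D (Suc (Suc j)) > 0")
  case True
  have "1 + \<kappa> \<le> 1 + \<kappa> * \<bar>X (Suc (Suc j))\<bar>"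
    using abs_X_gt_1[of "Suc j"] \<kappa>_bounds by simp
  also have "\<dots> \<le> 1 * \<bar>X (Suc (Suc j))\<bar>" using same_sign(2)[OF True] by simp
  also have "\<dots> \<le> \<bar>X (Suc j)\<bar> * \<bar>X (Suc (Suc j))\<bar>"
    using abs_X_gt_1[of j] by (intro mult_right_mono) auto
  finally show ?thesis .
next
  case False
  let ?f = "X (Suc j) - D (Suc j)"
  have "\<bar>X (Suc j)\<bar> = \<bar>real_of_int (D (Suc j))\<bar> + \<bar>?f\<bar>"
    using False D_sign[of j] D_sign[of "Suc j"] X_Suc_sign[of "Suc j"]
    by (cases "X (Suc j) > 0") (auto simp: zero_less_mult_iff)
  moreover have "\<bar>real_of_int (D (Suc j))\<bar> \<ge> 1" using D_sign(3)[of j] by linarith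
  moreover have "\<bar>?f\<bar> \<le> 1" using frac_bounds(3)[of "Suc j"] ab by linarith
  moreover have "A \<ge> 2 * C" if "A = B + C" "B \<ge> 1" "C \<le> 1" for A B C :: real using that by simp
  ultimately have "\<bar>X (Suc j)\<bar> \<ge> 2 * \<bar>?f\<bar>" by blast
  then have "\<bar>X (Suc j)\<bar> * \<bar>X (Suc (Suc j))\<bar> \<ge> 2 * \<bar>?f\<bar> * \<bar>X (Suc (Suc j))\<bar>"
    by (intro mult_right_mono) auto
  also have "2 * \<bar>?f\<bar> * \<bar>X (Suc (Suc j))\<bar> = 2 * \<bar>X (Suc (Suc j)) * ?f\<bar>" by (simp add: abs_mult)
  also have "\<dots> = 2" unfolding X_Suc_mult by simp
  finally show ?thesis using \<kappa>_bounds by linarith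
qed

lemma ln_X_pair: "ln \<bar>X (Suc j)\<bar> + ln \<bar>X (Suc (Suc j))\<bar> \<ge> ln (1 + \<kappa>)"
proof -
  have "ln (1 + \<kappa>) \<le> ln (\<bar>X (Suc j)\<bar> * \<bar>X (Suc (Suc j))\<bar>)"
    using X_pair_growth[of j] \<kappa>_bounds by (intro ln_mono) auto
  then show ?thesis using abs_X_gt_1[of j] abs_X_gt_1[of "Suc j"] by (simp add: ln_mult X_ne_int(3) split: if_splits)
qed

lemma ln_X_nonneg: "ln \<bar>X (Suc j)\<bar> \<ge> 0"
  using abs_X_gt_1[of j] by simp

lemma X_near_D: "\<bar>X (Suc j)\<bar> \<le> \<bar>real_of_int (D (Suc j))\<bar> + 1"
  using frac_bounds(3)[of "Suc j"] ab by linarith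

lemma ln_X_near_ln_D: "\<bar>ln \<bar>X (Suc j)\<bar> - ln \<bar>real_of_int (D (Suc j))\<bar>\<bar> \<le> ln 2"
proof -
  have D: "\<bar>real_of_int (D (Suc j))\<bar> \<ge> 1" using D_sign(3)[of j] by linarith
  have "\<bar>X (Suc j)\<bar> \<le> 2 * \<bar>real_of_int (D (Suc j))\<bar>" using X_near_D[of j] D by linarith
  then have "ln \<bar>X (Suc j)\<bar> \<le> ln (2 * \<bar>real_of_int (D (Suc j))\<bar>)"
    using abs_X_gt_1[of j] by (intro ln_mono) auto
  then have 1: "ln \<bar>X (Suc j)\<bar> \<le> ln 2 + ln \<bar>real_of_int (D (Suc j))\<bar>" using D by (simp add: ln_mult X_ne_int(3) split: if_splits)
  have "\<bar>real_of_int (D (Suc j))\<bar> \<le> 2 * \<bar>X (Suc j)\<bar>"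
    using frac_bounds(3)[of "Suc j"] ab abs_X_gt_1[of j] by linarith
  then have "ln \<bar>real_of_int (D (Suc j))\<bar> \<le> ln (2 * \<bar>X (Suc j)\<bar>)"
    using D by (intro ln_mono) auto
  then have 2: "ln \<bar>real_of_int (D (Suc j))\<bar> \<le> ln 2 + ln \<bar>X (Suc j)\<bar>" by (simp add: ln_mult X_ne_int(3))
  from 1 2 show ?thesis by linarith
qed

section \<open>Convergents and cusp excursions of a vertical geodesic\<close>

text \<open>
  The numerators and denominators of the convergents \<open>D 0 - 1 / (D 1 - 1 / (D 2 - \<dots>))\<close>.
\<close>

fun num :: "nat \<Rightarrow> int" where
  "num 0 = D 0"
| "num (Suc 0) = D 0 * D 1 - 1"
| "num (Suc (Suc j)) = D (Suc (Suc j)) * num (Suc j) - num j"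

fun den :: "nat \<Rightarrow> int" where
  "den 0 = 1"
| "den (Suc 0) = D 1"
| "den (Suc (Suc j)) = D (Suc (Suc j)) * den (Suc j) - den j"

text \<open>
  The quotient \<open>den (j - 1) / den j\<close> (with \<open>den (- 1) = 0\<close>), which is the image of \<open>\<infinity>\<close> under the
  transformation with rows \<open>(den (j - 1), - num (j - 1))\<close> and \<open>(den j, - num j)\<close>.
\<close>

primrec pole :: "nat \<Rightarrow> real" where
  "pole 0 = 0"
| "pole (Suc j) = 1 / (of_int (D (Suc j)) - pole j)"

definition "err j = of_int (den j) * x - of_int (num j)"

text \<open>
  The pole carries the sign of the last digit.  If the next digit has the opposite sign, then its
  absolute value is increased by subtracting the pole; if it has the same sign, then it is at least
  2 in absolute value and can afford the loss of 1.
\<close>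

lemma pole_bounds: "\<bar>pole j\<bar> \<le> 1 \<and> pole j * D j \<ge> 0"
  and pole_step: "\<bar>of_int (D (Suc j)) - pole j\<bar> \<ge> 1"
proof -
  have step: "\<bar>of_int (D (Suc j)) - pole j\<bar> \<ge> 1 \<and> (of_int (D (Suc j)) - pole j) * D (Suc j) \<ge> 0"
    if h: "\<bar>pole j\<bar> \<le> 1" "pole j * D j \<ge> 0" for j
  proof (cases "D j * D (Suc j) > 0")
    case True
    then have "\<bar>real_of_int (D (Suc j))\<bar> \<ge> 2" using same_sign(1)[of j] by linarith
    then show ?thesis using h(1)
      by (cases "D (Suc j) > 0") (auto simp: zero_le_mult_iff abs_if split: if_splits)
  next
    case False
    have le: "pole j * D (Suc j) \<le> 0"
    proof (cases "D j = 0")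
      case True
      then have "j = 0" using D_sign(3) by (cases j) auto
      then show ?thesis by simp
    next
      case False
      then show ?thesis using h(2) \<open>\<not> D j * D (Suc j) > 0\<close>
        by (auto simp: zero_le_mult_iff mult_le_0_iff zero_less_mult_iff not_less)
    qed
    then have "\<bar>of_int (D (Suc j)) - pole j\<bar> = \<bar>real_of_int (D (Suc j))\<bar> + \<bar>pole j\<bar>"
      by (auto simp: mult_le_0_iff abs_if)
    moreover have "\<bar>real_of_int (D (Suc j))\<bar> \<ge> 1" using D_sign(3)[of j] by linarith
    moreover have "(of_int (D (Suc j)) - pole j) * D (Suc j) = (real_of_int (D (Suc j)))\<^sup>2 - pole j * D (Suc j)"
      by (simp add: algebra_simps power2_eq_square)
    moreover have "(real_of_int (D (Suc j)))\<^sup>2 \<ge> 0" by simp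
    ultimately show ?thesis using le by linarith
  qed
  show *: "\<bar>pole j\<bar> \<le> 1 \<and> pole j * D j \<ge> 0" for j
  proof (induction j)
    case (Suc j)
    then show ?case using step[of j] by (auto simp: abs_divide zero_le_mult_iff zero_le_divide_iff divide_le_0_iff)
  qed simp
  then show "\<bar>of_int (D (Suc j)) - pole j\<bar> \<ge> 1" using step by blast
qed

lemma pole_den: "den j \<noteq> 0 \<and> real_of_int (den j) = pole (Suc j) * den (Suc j)"
proof (induction j)
  case 0
  show ?case using D_sign(3)[of 0] by simp
next
  case (Suc j)
  have ne: "of_int (D (Suc (Suc j))) - pole (Suc j) \<noteq> 0" using pole_step[of "Suc j"] by auto
  have "real_of_int (den (Suc (Suc j))) = (of_int (D (Suc (Suc j))) - pole (Suc j)) * den (Suc j)"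
    using Suc by (simp add: algebra_simps del: pole.simps)
  then have "real_of_int (den (Suc j)) = pole (Suc (Suc j)) * den (Suc (Suc j))"
    using ne by (simp add: field_simps)
  moreover have "den (Suc j) \<noteq> 0" using Suc by auto
  ultimately show ?case by blast
qed

lemma convergents_det: "num j * den (Suc j) - num (Suc j) * den j = 1"
  by (induction j) (auto simp: algebra_simps)

lemma coprime_convergent: "coprime (den j) (- num j)"
proof (rule coprimeI)
  fix l assume "l dvd den j" "l dvd - num j"
  then have "l dvd num j * den (Suc j) - num (Suc j) * den j" by (intro dvd_diff) auto
  then show "is_unit l" unfolding convergents_det .
qed

lemma err_0: "X 1 * err 0 = - 1"
  using X_Suc_mult[of 0] by (simp add: err_def)

text \<open>
  The transformation described at \<open>pole\<close> maps \<open>x\<close> to \<open>X (Suc j)\<close>, so that the remainders are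
  quotients of consecutive errors.
\<close>

lemma err_Suc: "err j = X (Suc (Suc j)) * err (Suc j)"
proof (induction j)
  case 0
  have "err 1 = of_int (D 1) * err 0 - X 1 * - err 0 - X 1 * err 0 + 1"
    by (simp add: err_def algebra_simps)
  then have "err 1 = - (X 1 - D 1) * err 0"
    using err_0 by (simp add: err_def algebra_simps)
  then have "X 2 * err 1 = - (X 2 * (X 1 - D 1)) * err 0" by (simp only:) (simp add: algebra_simps)
  also have "\<dots> = err 0" using X_Suc_mult[of 1] by (simp add: numeral_2_eq_2)
  finally show ?case by (simp add: numeral_2_eq_2)
next
  case (Suc j)
  have "err (Suc (Suc j)) = of_int (D (Suc (Suc j))) * err (Suc j) - err j"
    by (simp add: err_def algebra_simps)
  also have "\<dots> = - (X (Suc (Suc j)) - D (Suc (Suc j))) * err (Suc j)"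
    unfolding Suc by (simp add: algebra_simps)
  finally have "X (Suc (Suc (Suc j))) * err (Suc (Suc j)) =
     - (X (Suc (Suc (Suc j))) * (X (Suc (Suc j)) - D (Suc (Suc j)))) * err (Suc j)"
    by (simp only:) (simp add: algebra_simps)
  then show ?case using X_Suc_mult[of "Suc (Suc j)"] by simp
qed

text \<open>
  The two images \<open>X (Suc j)\<close> and \<open>pole j\<close> of \<open>x\<close> and \<open>\<infinity>\<close> are fractions with denominators \<open>err j\<close> and
  \<open>den j\<close>; up to sign, their difference has the determinant 1 of the transformation as its numerator.
\<close>

lemma area: "\<bar>real_of_int (den j)\<bar> * \<bar>X (Suc j) - pole j\<bar> * \<bar>err j\<bar> = 1"
proof (cases j)
  case 0
  then show ?thesis using arg_cong[OF err_0, of abs] by (simp add: abs_mult)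
next
  case (Suc i)
  have "real_of_int (den (Suc i)) * (X (Suc (Suc i)) - pole (Suc i)) * err (Suc i) =
     den (Suc i) * (X (Suc (Suc i)) * err (Suc i)) - (pole (Suc i) * den (Suc i)) * err (Suc i)"
    by (simp add: algebra_simps del: pole.simps)
  also have "\<dots> = den (Suc i) * err i - den i * err (Suc i)"
    using err_Suc[of i] pole_den[of i] by simp
  also have "\<dots> = - real_of_int (num i * den (Suc i) - num (Suc i) * den i)"
    by (simp add: err_def algebra_simps)
  also have "\<dots> = - 1" unfolding convergents_det by simp
  finally show ?thesis unfolding Suc by (metis abs_1 abs_minus abs_mult)
qed

lemma gap_lower: "\<bar>X (Suc j) - pole j\<bar> \<ge> \<kappa> * \<bar>X (Suc j)\<bar>"
proof (cases "D j * D (Suc j) > 0")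
  case True
  then show ?thesis using same_sign(2)[OF True] pole_bounds[of j] by linarith
next
  case False
  have "pole j * X (Suc j) \<le> 0"
  proof (cases "D j = 0")
    case True
    then have "j = 0" using D_sign(3) by (cases j) auto
    then show ?thesis by simp
  next
    case False
    then show ?thesis using pole_bounds[of j] \<open>\<not> D j * D (Suc j) > 0\<close> D_sign[of j]
      by (auto simp: zero_le_mult_iff mult_le_0_iff zero_less_mult_iff not_less)
  qed
  then have "\<bar>X (Suc j) - pole j\<bar> \<ge> 1 * \<bar>X (Suc j)\<bar>"
    by (auto simp: mult_le_0_iff abs_if)
  moreover have "\<kappa> * \<bar>X (Suc j)\<bar> \<le> 1 * \<bar>X (Suc j)\<bar>"
    using \<kappa>_bounds by (intro mult_right_mono) auto
  ultimately show ?thesis by linarith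
qed

lemma gap_upper: "\<bar>X (Suc j) - pole j\<bar> \<le> \<bar>X (Suc j)\<bar> + 1"
  using pole_bounds[of j] by linarith

text \<open>
  The diameter of the half circle that is the image of the vertical geodesic over \<open>x\<close>.
\<close>

definition "gap j = \<bar>X (Suc j) - pole j\<bar>"

lemma gap_pos: "gap j > 0"
  using gap_lower[of j] abs_X_gt_1[of j] \<kappa>_bounds
  unfolding gap_def by (smt (verit) mult_pos_pos)

text \<open>
  The time that the vertical geodesic \<open>x + \<i> e\<^sup>-\<^sup>h\<close> needs to descend from height 1 to the square of the
  last error.
\<close>

definition "cf_time j = 2 * (\<Sum>i<j. ln \<bar>X (Suc i)\<bar>)"

lemma err_time: "(err j)\<^sup>2 = exp (- cf_time (Suc j))"
proof (induction j)
  case 0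
  have "(err 0)\<^sup>2 * (X 1)\<^sup>2 = 1"
    using err_0 by (metis mult.commute power2_minus power_mult_distrib power_one)
  moreover have "exp (- cf_time (Suc 0)) * (X 1)\<^sup>2 = 1"
    using abs_X_gt_1[of 0] by (simp add: cf_time_def exp_minus exp_double_real)
  ultimately show ?case using X_ne_int(3)[of 1]
    by (metis mult_cancel_right power2_eq_square mult_eq_0_iff)
next
  case (Suc j)
  have "exp (- cf_time (Suc (Suc j))) * (X (Suc (Suc j)))\<^sup>2 = exp (- cf_time (Suc j))"
    using abs_X_gt_1[of "Suc j"]
    by (simp add: cf_time_def exp_minus exp_add exp_diff distrib_left exp_double_real)
  moreover have "(err (Suc j))\<^sup>2 * (X (Suc (Suc j)))\<^sup>2 = (err j)\<^sup>2"
    by (simp add: err_Suc[of j] power_mult_distrib mult.commute)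
  ultimately show ?case using Suc X_ne_int(3)[of "Suc (Suc j)"]
    by (metis mult_cancel_right power2_eq_square mult_eq_0_iff)
qed

text \<open>
  The height along a half circle of diameter \<open>gap j\<close>, as a function of the distance parameter \<open>s\<close> that is
  exponential in time; the top is reached at \<open>s = gap j\<close>.
\<close>

lemma height_formula:
  fixes h :: real and j :: nat
  defines "s \<equiv> exp (cf_time (Suc j) - h)"
  shows "cusp_height (den j) (- num j) (Complex x (exp (- h))) = s / (1 + (s / gap j)\<^sup>2)"
proof -
  define e where "e = (err j)\<^sup>2"
  have e: "e = exp (- cf_time (Suc j))" unfolding e_def by (rule err_time)
  have epos: "e > 0" by (simp add: e)
  have q: "(real_of_int (den j))\<^sup>2 = 1 / ((gap j)\<^sup>2 * e)"
  proof -
    have "(\<bar>real_of_int (den j)\<bar> * gap j * \<bar>err j\<bar>)\<^sup>2 = 1" using area[of j] by (simp add: gap_def)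
    then show ?thesis using gap_pos[of j] epos by (simp add: e_def power_mult_distrib field_simps)
  qed
  have y: "exp (- h) = s * e" by (simp add: s_def e flip: exp_add)
  have "(norm (of_int (den j) * Complex x (exp (- h)) + of_int (- num j)))\<^sup>2 =
     e + (real_of_int (den j))\<^sup>2 * (s * e)\<^sup>2"
    by (simp add: cmod_power2 e_def err_def y[symmetric, unfolded e_def err_def] power_mult_distrib)
  also have "\<dots> = e * (1 + (s / gap j)\<^sup>2)"
    unfolding q using epos gap_pos[of j] by (simp add: field_simps power2_eq_square)
  finally show ?thesis using epos by (simp add: cusp_height_def y)
qed

lemma cf_time_Suc: "cf_time (Suc j) = cf_time j + 2 * ln \<bar>X (Suc j)\<bar>"
  by (simp add: cf_time_def)

lemma exp_2_ln: "exp (2 * ln \<bar>X (Suc j)\<bar>) = (X (Suc j))\<^sup>2"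
  unfolding exp_double_real using abs_X_gt_1[of j] by simp

text \<open>
  Between the two cutting times \<open>s\<close> runs from \<open>X\<^sup>2\<close> down to 1, so that the height over the cusp
  \<open>num j / den j\<close> is at least \<open>\<kappa>\<^sup>2 / (1 + \<kappa>\<^sup>2)\<close>; it is at most the radius \<open>gap j / 2\<close>.  By exclusivity the
  lower bound limits the height over every other cusp.
\<close>

lemma no_excursion:
  assumes "cf_time j \<le> h" "h \<le> cf_time (Suc j)" "\<bar>X (Suc j)\<bar> \<le> H" "coprime m n"
  shows "cusp_height m n (Complex x (exp (- h))) \<le> max ((H + 1) / 2) ((1 + \<kappa>\<^sup>2) / \<kappa>\<^sup>2)"
proof -
  define s where "s = exp (cf_time (Suc j) - h)"
  define hj where "hj = cusp_height (den j) (- num j) (Complex x (exp (- h)))"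
  have hj: "hj = s / (1 + (s / gap j)\<^sup>2)" unfolding hj_def s_def by (rule height_formula)
  have s1: "s \<ge> 1" using assms(2) by (simp add: s_def)
  have "s \<le> exp (2 * ln \<bar>X (Suc j)\<bar>)" using assms(1) by (simp add: s_def cf_time_Suc)
  then have s2: "s \<le> (X (Suc j))\<^sup>2" by (simp only: exp_2_ln)
  have g: "gap j > 0" by (rule gap_pos)
  have "2 * (s / gap j) \<le> 1 + (s / gap j)\<^sup>2"
    using zero_le_power2[of "s / gap j - 1"] by (simp add: power2_diff)
  then have "s \<le> gap j / 2 * (1 + (s / gap j)\<^sup>2)" using g by (simp add: field_simps)
  then have "hj \<le> gap j / 2" unfolding hj by (simp add: divide_le_eq add_pos_nonneg)
  also have "\<dots> \<le> (H + 1) / 2" using gap_upper[of j] assms(3) by (simp add: gap_def)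
  finally have up: "hj \<le> (H + 1) / 2" .
  have "(\<kappa> * \<bar>X (Suc j)\<bar>)\<^sup>2 \<le> (gap j)\<^sup>2"
    using gap_lower[of j] \<kappa>_bounds unfolding gap_def by (intro power_mono) auto
  then have "\<kappa>\<^sup>2 * s \<le> (gap j)\<^sup>2"
    using mult_left_mono[OF s2, of "\<kappa>\<^sup>2"] by (simp add: power_mult_distrib)
  then have "s * (\<kappa>\<^sup>2 * s) \<le> s * (gap j)\<^sup>2" using s1 by (intro mult_left_mono) auto
  then have "(s / gap j)\<^sup>2 \<le> s / \<kappa>\<^sup>2"
    using g \<kappa>_bounds by (simp add: field_simps power2_eq_square)
  moreover have "s * ((1 + \<kappa>\<^sup>2) / \<kappa>\<^sup>2) = s / \<kappa>\<^sup>2 + s"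
    using \<kappa>_bounds by (simp add: field_simps)
  ultimately have "1 + (s / gap j)\<^sup>2 \<le> s * ((1 + \<kappa>\<^sup>2) / \<kappa>\<^sup>2)" using s1 by linarith
  moreover have "1 + (s / gap j)\<^sup>2 > 0" by (simp add: add_pos_nonneg)
  ultimately have "1 \<le> s * ((1 + \<kappa>\<^sup>2) / \<kappa>\<^sup>2) / (1 + (s / gap j)\<^sup>2)" by (simp only: le_divide_eq_1_pos)
  then have lo: "1 \<le> hj * ((1 + \<kappa>\<^sup>2) / \<kappa>\<^sup>2)" unfolding hj by (simp add: mult.commute)
  have hjpos: "hj > 0" using hj s1 by (simp add: add_pos_nonneg)
  have "cusp_height m n (Complex x (exp (- h))) = hj \<or> cusp_height m n (Complex x (exp (- h))) * hj \<le> 1"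
    unfolding hj_def by (rule cusp_heights_exclusive[OF assms(4) coprime_convergent]) simp
  then consider "cusp_height m n (Complex x (exp (- h))) = hj"
    | "cusp_height m n (Complex x (exp (- h))) * hj \<le> 1"
    by blast
  then show ?thesis
  proof cases
    case 1
    then show ?thesis using up by (simp only: max.coboundedI1)
  next
    case 2
    then have "cusp_height m n (Complex x (exp (- h))) * hj \<le> ((1 + \<kappa>\<^sup>2) / \<kappa>\<^sup>2) * hj"
      using lo by (simp only: mult.commute)
    then have "cusp_height m n (Complex x (exp (- h))) \<le> (1 + \<kappa>\<^sup>2) / \<kappa>\<^sup>2"
      using hjpos by (simp only: mult_le_cancel_right_pos)
    then show ?thesis by (rule max.coboundedI2)
  qed
qed

text \<open>
  On the descending half \<open>s \<le> gap j\<close> the height is at least \<open>s / 2\<close>, on the ascending half it is at least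
  \<open>(gap j)\<^sup>2 / (2 s)\<close>; the two end pieces that are left out have lengths that depend only on \<open>d\<close> and \<open>\<kappa>\<close>.
\<close>

lemma excursion:
  assumes "d > 0" "h \<le> cf_time (Suc j) - ln (2 * d)" "cf_time j + ln (2 * d) - 2 * ln \<kappa> \<le> h"
  shows "cusp_height (den j) (- num j) (Complex x (exp (- h))) \<ge> d"
proof -
  define s where "s = exp (cf_time (Suc j) - h)"
  have g: "gap j > 0" by (rule gap_pos)
  have spos: "s > 0" by (simp add: s_def)
  have "2 * d = exp (ln (2 * d))" using assms(1) by simp
  also have "\<dots> \<le> s" using assms(2) by (simp add: s_def)
  finally have s1: "2 * d \<le> s" .
  have "2 * d * s = exp (ln (2 * d) + (cf_time (Suc j) - h))" using assms(1) by (simp add: s_def exp_add)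
  also have "\<dots> \<le> exp (2 * ln \<bar>X (Suc j)\<bar> + 2 * ln \<kappa>)" using assms(3) by (simp add: cf_time_Suc)
  also have "\<dots> = (\<kappa> * X (Suc j))\<^sup>2"
    unfolding exp_add exp_2_ln using \<kappa>_bounds by (simp add: exp_double_real power_mult_distrib)
  also have "\<dots> \<le> (gap j)\<^sup>2"
    using gap_lower[of j] \<kappa>_bounds unfolding gap_def power2_abs[of "\<kappa> * X (Suc j)", symmetric]
    by (intro power_mono) (auto simp: abs_mult)
  finally have "d * s\<^sup>2 / (gap j)\<^sup>2 \<le> s / 2"
    using g spos by (simp add: field_simps power2_eq_square)
  then have "d * (s / gap j)\<^sup>2 \<le> s / 2" by (simp add: power_divide)
  then have "d * (1 + (s / gap j)\<^sup>2) \<le> s" using s1 by (simp only: distrib_left)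
  then show ?thesis unfolding height_formula s_def[symmetric] by (simp add: le_divide_eq add_pos_nonneg)
qed

end

section \<open>Averages along a sequence of excursion times\<close>

text \<open>
  Both time averages and digit averages are treated through this form, in which sums and error
  terms can be added without division.
\<close>

lemma average_null_iff:
  fixes G N :: "'a \<Rightarrow> real"
  assumes N: "filterlim N at_top \<F>" and G: "\<forall>\<^sub>F x in \<F>. G x \<ge> 0"
  shows "((\<lambda>x. 1 / N x * G x) \<longlongrightarrow> 0) \<F> \<longleftrightarrow> (\<forall>\<epsilon>>0. \<forall>\<^sub>F x in \<F>. G x \<le> \<epsilon> * N x)"
proof
  have Npos: "\<forall>\<^sub>F x in \<F>. N x > 0" using N by (simp add: filterlim_at_top_dense)
  {
    assume L: "((\<lambda>x. 1 / N x * G x) \<longlongrightarrow> 0) \<F>"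
    show "\<forall>\<epsilon>>0. \<forall>\<^sub>F x in \<F>. G x \<le> \<epsilon> * N x"
    proof (intro allI impI)
      fix \<epsilon> :: real assume "\<epsilon> > 0"
      from order_tendstoD(2)[OF L this] Npos show "\<forall>\<^sub>F x in \<F>. G x \<le> \<epsilon> * N x"
        by eventually_elim (simp add: field_simps)
    qed
  next
    assume R: "\<forall>\<epsilon>>0. \<forall>\<^sub>F x in \<F>. G x \<le> \<epsilon> * N x"
    show "((\<lambda>x. 1 / N x * G x) \<longlongrightarrow> 0) \<F>"
    proof (rule order_tendstoI)
      fix a :: real assume "a < 0"
      from G Npos show "\<forall>\<^sub>F x in \<F>. a < 1 / N x * G x"
        by eventually_elim (use \<open>a < 0\<close> in \<open>smt (verit) divide_nonneg_pos mult_nonneg_nonneg\<close>)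
    next
      fix a :: real assume a: "0 < a"
      then have "\<forall>\<^sub>F x in \<F>. G x \<le> a / 2 * N x" by (intro R[rule_format]) simp
      from this Npos show "\<forall>\<^sub>F x in \<F>. 1 / N x * G x < a"
      proof eventually_elim
        case (elim x)
        then have "1 / N x * G x \<le> a / 2" by (simp add: field_simps)
        then show ?case using a by linarith
      qed
    qed
  }
qed

lemma eventually_linear_le:
  assumes "\<alpha> < (\<beta>::real)"
  shows "\<forall>\<^sub>F n in sequentially. c + \<alpha> * real n \<le> \<beta> * real n"
proof -
  have "\<forall>\<^sub>F n in sequentially. c / (\<beta> - \<alpha>) \<le> real n"
    using filterlim_real_sequentially by (simp add: filterlim_at_top)
  then show ?thesis
    by eventually_elim (use assms in \<open>simp add: field_simps\<close>)
qed

text \<open>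
  An inequality for all late increments gives one for the sums, at the price of a constant that
  absorbs the early terms.
\<close>

lemma increment_bound:
  fixes f g :: "nat \<Rightarrow> real"
  assumes "\<forall>\<^sub>F j in sequentially. f (Suc j) - f j \<le> g j"
  shows "\<exists>c. \<forall>n. f n \<le> c + (\<Sum>j<n. g j)"
proof -
  obtain N where N: "\<And>j. j \<ge> N \<Longrightarrow> f (Suc j) - f j \<le> g j"
    using assms unfolding eventually_sequentially by blast
  define h where "h n = f n - (\<Sum>j<n. g j)" for n
  define c where "c = Max (h ` {..N})"
  have small: "h n \<le> c" if "n \<le> N" for n
    unfolding c_def using that by (intro Max_ge) auto
  have "h n \<le> c" for n
  proof (induction n)
    case (Suc n)
    show ?case
    proof (cases "n < N")
      case False
      then have "h (Suc n) \<le> h n" using N[of n] by (simp add: h_def)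
      then show ?thesis using Suc by linarith
    qed (use small in simp)
  qed (use small in simp)
  then show ?thesis by (intro exI[of _ c]) (simp add: h_def algebra_simps)
qed

lemma sum_pair_le:
  fixes f :: "nat \<Rightarrow> real"
  assumes "\<And>j. f j \<ge> 0"
  shows "(\<Sum>j<n. f j + f (Suc j)) \<le> 2 * (\<Sum>j<Suc n. f j)"
proof -
  have "(\<Sum>j<n. f (Suc j)) = (\<Sum>j<Suc n. f j) - f 0"
    by (simp only: sum.lessThan_Suc_shift)
  then show ?thesis using assms[of 0] assms[of n] by (simp add: sum.distrib)
qed

text \<open>
  Cutting times with half segment lengths \<open>l\<close>, of which two consecutive ones are never both short.
\<close>

locale growing_times =
  fixes \<sigma> l :: "nat \<Rightarrow> real" and \<eta> :: real
  assumes \<sigma>_Suc: "\<And>j. \<sigma> (Suc j) = \<sigma> j + 2 * l j"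
    and l_nonneg: "\<And>j. l j \<ge> 0"
    and \<eta>_pos: "\<eta> > 0"
    and l_pair: "\<And>j. l j + l (Suc j) \<ge> \<eta>"
begin

lemma \<sigma>_eq: "\<sigma> n = \<sigma> 0 + 2 * (\<Sum>j<n. l j)"
  by (induction n) (auto simp: \<sigma>_Suc)

lemma \<sigma>_lower: "\<sigma> (Suc n) \<ge> \<sigma> 0 + \<eta> * n"
proof -
  have "\<eta> * n = (\<Sum>j<n. \<eta>)" by simp
  also have "\<dots> \<le> (\<Sum>j<n. l j + l (Suc j))" by (intro sum_mono l_pair)
  also have "\<dots> \<le> 2 * (\<Sum>j<Suc n. l j)" by (rule sum_pair_le[OF l_nonneg])
  finally show ?thesis using \<sigma>_eq[of "Suc n"] by simp
qed

lemma \<sigma>_lower': "\<sigma> n \<ge> \<sigma> 0 - \<eta> + \<eta> * n"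
  using \<sigma>_lower[of "n - 1"] \<eta>_pos by (cases n) (auto simp: algebra_simps)

lemma \<sigma>_mono: "m \<le> n \<Longrightarrow> \<sigma> m \<le> \<sigma> n"
  by (rule lift_Suc_mono_le[of \<sigma>]) (use l_nonneg in \<open>simp_all add: \<sigma>_Suc\<close>)

lemma \<sigma>_at_top: "filterlim \<sigma> at_top sequentially"
  unfolding filterlim_at_top
proof
  fix Z
  have "\<forall>\<^sub>F n in sequentially. (Z - \<sigma> 0 + \<eta>) + 0 * real n \<le> \<eta> * real n"
    by (rule eventually_linear_le[OF \<eta>_pos])
  then show "\<forall>\<^sub>F n in sequentially. Z \<le> \<sigma> n"
    by eventually_elim (use \<sigma>_lower' in \<open>smt (verit)\<close>)
qed

lemma \<sigma>_nonneg: "\<forall>\<^sub>F n in sequentially. \<sigma> n \<ge> 0"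
  using \<sigma>_at_top by (simp add: filterlim_at_top)

end

text \<open>
  Here \<open>F d L\<close> stands for the time spent above level \<open>d\<close> up to time \<open>L\<close>, and \<open>q\<close> for the digits.  The
  assumption \<open>deep\<close> says that a segment is in the cusp up to a piece of bounded length; \<open>shallow\<close> says
  that a segment with a small digit avoids a cusp neighbourhood that is high enough.
\<close>

locale excursion_times = growing_times \<sigma> l \<eta>
  for \<sigma> l :: "nat \<Rightarrow> real" and \<eta> :: real +
  fixes F :: "real \<Rightarrow> real \<Rightarrow> real" and q :: "nat \<Rightarrow> int"
  assumes F_incr: "\<And>d s t. 0 \<le> s \<Longrightarrow> s \<le> t \<Longrightarrow> 0 \<le> F d t - F d s \<and> F d t - F d s \<le> t - s"
    and q_nonzero: "\<And>j. q (Suc j) \<noteq> 0"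
    and l_near: "\<And>j. \<bar>l j - ln \<bar>real_of_int (q (Suc j))\<bar>\<bar> \<le> ln 2"
    and deep: "\<And>d. d > 1 \<Longrightarrow> \<exists>C. \<forall>\<^sub>F j in sequentially. F d (\<sigma> (Suc j)) - F d (\<sigma> j) \<ge> 2 * l j - C"
    and shallow: "\<And>\<xi>. \<xi> > 1 \<Longrightarrow> \<exists>d>1. \<forall>\<^sub>F j in sequentially.
        \<bar>real_of_int (q (Suc j))\<bar> \<le> \<xi> \<longrightarrow> F d (\<sigma> (Suc j)) = F d (\<sigma> j)"
begin

definition "lq j = ln \<bar>real_of_int (q (Suc j))\<bar>"
abbreviation "big \<xi> j \<equiv> \<bar>real_of_int (q (Suc j))\<bar> > \<xi>"

text \<open>
  The contribution of the large digits, which is the sum in \<open>log_average\<close> of the truncated digits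
  without its first term.
\<close>

definition "B \<xi> n = (\<Sum>j<n. if big \<xi> j then lq j else 0)"

lemma l_near_lq: "\<bar>l j - lq j\<bar> \<le> ln 2"
  using l_near by (simp add: lq_def)

lemma lq_big: "\<xi> > 1 \<Longrightarrow> big \<xi> j \<Longrightarrow> ln \<xi> \<le> lq j"
  unfolding lq_def by (intro ln_mono) auto

lemma lq_small: "\<not> big \<xi> j \<Longrightarrow> lq j \<le> ln \<xi>"
  unfolding lq_def using q_nonzero[of j] by (intro ln_mono) auto

lemma F_step: "\<forall>\<^sub>F j in sequentially. 0 \<le> F d (\<sigma> (Suc j)) - F d (\<sigma> j) \<and> F d (\<sigma> (Suc j)) - F d (\<sigma> j) \<le> 2 * l j"
  using \<sigma>_nonneg
proof eventually_elim
  case (elim j)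
  then show ?case using F_incr[OF elim, of "\<sigma> (Suc j)" d] l_nonneg[of j] \<sigma>_Suc[of j] by simp
qed

text \<open>
  Between \<open>\<sigma> n\<close> and \<open>\<sigma> (Suc n)\<close> the segment may be very long; a monotone \<open>G\<close> is controlled by its
  value at the end of the segment and by the time at its beginning.
\<close>

lemma from_\<sigma>_to_all:
  assumes mono: "\<And>s t. 0 \<le> s \<Longrightarrow> s \<le> t \<Longrightarrow> G s \<le> (G t :: real)"
    and \<epsilon>: "\<epsilon> > 0" and ev: "\<forall>\<^sub>F n in sequentially. G (\<sigma> (Suc n)) \<le> \<epsilon> * \<sigma> n"
  shows "\<forall>\<^sub>F L in at_top. G L \<le> \<epsilon> * L"
proof -
  obtain N where N: "\<And>n. n \<ge> N \<Longrightarrow> G (\<sigma> (Suc n)) \<le> \<epsilon> * \<sigma> n \<and> \<sigma> n \<ge> 0"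
    using eventually_conj[OF ev \<sigma>_nonneg] unfolding eventually_sequentially by blast
  have "G L \<le> \<epsilon> * L" if L: "L \<ge> \<sigma> N" for L
  proof -
    obtain m0 where "L < \<sigma> m0"
      using \<sigma>_at_top unfolding filterlim_at_top_dense eventually_sequentially by blast
    define m where "m = (LEAST m. L < \<sigma> m)"
    have m: "L < \<sigma> m" unfolding m_def by (rule LeastI) fact
    have "m > N" using m L \<sigma>_mono[of m N] by (meson not_less order_le_less_trans leD)
    then obtain n where n: "m = Suc n" "n \<ge> N" by (metis less_Suc_eq_le less_imp_Suc_add add_Suc_right le_add1)
    have "\<not> L < \<sigma> n" using not_less_Least[of n "\<lambda>m. L < \<sigma> m"] n by (simp add: m_def)
    then have le: "\<sigma> n \<le> L" by simp
    have "G L \<le> G (\<sigma> (Suc n))" using m n N[OF n(2)] le by (intro mono) auto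
    also have "\<dots> \<le> \<epsilon> * \<sigma> n" using N[OF n(2)] by simp
    also have "\<dots> \<le> \<epsilon> * L" using le \<epsilon> by simp
    finally show ?thesis .
  qed
  then show ?thesis unfolding eventually_at_top_linorder by blast
qed

text \<open>
  For \<open>\<xi>\<close> large in terms of the constant in \<open>deep\<close>, every segment with a large digit spends at least \<open>lq j\<close>
  in the cusp.  This bounds \<open>B \<xi> n\<close> by the time in the cusp, which is \<open>o(\<sigma> n)\<close>.  As the segments with
  small digits are bounded, \<open>\<sigma> n\<close> is \<open>O(n) + 2 B \<xi> n\<close>, hence \<open>O(n)\<close>.
\<close>

lemma zero_imp_B_small:
  assumes d: "d > 1" and Z: "\<And>\<epsilon>. \<epsilon> > 0 \<Longrightarrow> \<forall>\<^sub>F L in at_top. F d L \<le> \<epsilon> * L"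
  shows "\<exists>\<xi>>1. \<forall>\<epsilon>>0. \<forall>\<^sub>F n in sequentially. B \<xi> n \<le> \<epsilon> * real n"
proof -
  have Z\<sigma>: "\<forall>\<^sub>F n in sequentially. F d (\<sigma> n) \<le> \<epsilon> * \<sigma> n" if "\<epsilon> > 0" for \<epsilon>
    by (rule eventually_compose_filterlim[OF Z[OF that] \<sigma>_at_top])
  obtain C where C: "\<forall>\<^sub>F j in sequentially. F d (\<sigma> (Suc j)) - F d (\<sigma> j) \<ge> 2 * l j - C"
    using deep[OF d] by blast
  \<comment> \<open>large enough for \<open>2 l j - C \<ge> lq j\<close> whenever \<open>lq j \<ge> lx\<close>, as \<open>l j \<ge> lq j - ln 2\<close>\<close>
  define lx where "lx = \<bar>C\<bar> + 2 * ln 2 + 1"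
  define \<xi> where "\<xi> = exp lx"
  have lx: "lx > 0" unfolding lx_def by (smt (verit) ln_gt_zero)
  then have \<xi>: "\<xi> > 1" "ln \<xi> = lx" by (simp_all add: \<xi>_def)
  have "\<forall>\<^sub>F j in sequentially. (B \<xi> (Suc j) - F d (\<sigma> (Suc j))) - (B \<xi> j - F d (\<sigma> j)) \<le> 0"
    using C F_step[of d]
  proof eventually_elim
    case (elim j)
    show ?case
    proof (cases "big \<xi> j")
      case True
      have "lq j \<ge> lx" using lq_big[OF \<xi>(1) True] \<xi>(2) by simp
      then show ?thesis using elim l_near_lq[of j] True by (simp add: B_def lx_def)
    qed (use elim in \<open>simp add: B_def\<close>)
  qed
  from increment_bound[OF this] obtain c where "\<And>n. B \<xi> n - F d (\<sigma> n) \<le> c + (\<Sum>j<n. 0)"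
    by blast
  then have BF: "B \<xi> n \<le> c + F d (\<sigma> n)" for n by (simp add: algebra_simps)
  define K where "K = 2 * (lx + ln 2)"
  have K: "K > 0" unfolding K_def using lx by (smt (verit) ln_gt_zero)
  have \<sigma>B: "\<sigma> n \<le> \<sigma> 0 + 2 * B \<xi> n + K * n" for n
  proof -
    have "(\<Sum>j<n. l j) \<le> (\<Sum>j<n. (if big \<xi> j then lq j else 0) + (lx + ln 2))"
    proof (rule sum_mono)
      fix j
      show "l j \<le> (if big \<xi> j then lq j else 0) + (lx + ln 2)"
        using l_near_lq[of j] lq_small[of \<xi> j] \<xi>(2) lx by (cases "big \<xi> j") auto
    qed
    also have "\<dots> = B \<xi> n + real n * (lx + ln 2)" by (simp add: B_def sum.distrib)
    finally show ?thesis unfolding \<sigma>_eq[of n] K_def by (simp add: algebra_simps)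
  qed
  have ev1: "\<forall>\<^sub>F n in sequentially. \<sigma> n \<le> (2 * K + 1) * real n"
  proof -
    have "\<forall>\<^sub>F n in sequentially. F d (\<sigma> n) \<le> 1 / 4 * \<sigma> n" by (rule Z\<sigma>) simp
    moreover have "\<forall>\<^sub>F n in sequentially. (2 * \<sigma> 0 + 4 * c) + 2 * K * real n \<le> (2 * K + 1) * real n"
      by (rule eventually_linear_le) simp
    ultimately show ?thesis
    proof eventually_elim
      case (elim n)
      then show ?case using \<sigma>B[of n] BF[of n] by (simp add: algebra_simps)
    qed
  qed
  have "\<forall>\<^sub>F n in sequentially. B \<xi> n \<le> \<epsilon> * real n" if \<epsilon>: "\<epsilon> > 0" for \<epsilon>
  proof -
    define \<delta> where "\<delta> = \<epsilon> / (2 * (2 * K + 1))"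
    have \<delta>: "\<delta> > 0" using \<epsilon> K by (simp add: \<delta>_def)
    have \<delta>K: "\<delta> * ((2 * K + 1) * n) = \<epsilon> / 2 * n" for n :: real
      using K by (simp add: \<delta>_def field_simps)
    have lin: "\<forall>\<^sub>F n in sequentially. c + \<epsilon> / 2 * real n \<le> \<epsilon> * real n"
      using \<epsilon> by (intro eventually_linear_le) simp
    show ?thesis using Z\<sigma>[OF \<delta>] ev1 lin
    proof eventually_elim
      case (elim n)
      have "B \<xi> n \<le> c + \<delta> * \<sigma> n" using BF[of n] elim(1) by simp
      also have "\<delta> * \<sigma> n \<le> \<delta> * ((2 * K + 1) * n)" using elim(2) \<delta> by (intro mult_left_mono) auto
      finally show ?case unfolding \<delta>K using elim(3) by simp
    qed
  qed
  then show ?thesis using \<xi> by blast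
qed

text \<open>
  Above the level given by \<open>shallow\<close> only the segments with large digits count, and each contributes
  at most a multiple of \<open>lq j\<close>; on the other hand \<open>\<sigma> n\<close> grows at least linearly.
\<close>

lemma B_small_imp_zero:
  assumes \<xi>: "\<xi> > 1" and B: "\<And>\<epsilon>. \<epsilon> > 0 \<Longrightarrow> \<forall>\<^sub>F n in sequentially. B \<xi> n \<le> \<epsilon> * real n"
  shows "\<exists>d>1. \<forall>\<epsilon>>0. \<forall>\<^sub>F L in at_top. F d L \<le> \<epsilon> * L"
proof -
  obtain d where d: "d > 1" and sh: "\<forall>\<^sub>F j in sequentially. \<not> big \<xi> j \<longrightarrow> F d (\<sigma> (Suc j)) = F d (\<sigma> j)"
    using shallow[OF \<xi>] by (auto simp: not_less)
  define K where "K = 2 * (1 + ln 2 / ln \<xi>)"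
  have lx: "ln \<xi> > 0" using \<xi> by simp
  have K: "K > 0" using lx unfolding K_def by (smt (verit) divide_nonneg_pos ln_gt_zero)
  have "\<forall>\<^sub>F j in sequentially. (F d (\<sigma> (Suc j)) - K * B \<xi> (Suc j)) - (F d (\<sigma> j) - K * B \<xi> j) \<le> 0"
    using sh F_step[of d]
  proof eventually_elim
    case (elim j)
    show ?case
    proof (cases "big \<xi> j")
      case True
      have "ln 2 \<le> ln 2 / ln \<xi> * lq j"
        using lq_big[OF \<xi> True] lx by (simp add: field_simps)
      then have "2 * (lq j + ln 2) \<le> K * lq j" by (simp add: K_def algebra_simps)
      moreover have "2 * l j \<le> 2 * (lq j + ln 2)" using l_near_lq[of j] by simp
      ultimately have "F d (\<sigma> (Suc j)) - F d (\<sigma> j) \<le> K * lq j"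
        using conjunct2[OF elim(2)] by (meson order_trans)
      then show ?thesis using True by (simp add: B_def algebra_simps)
    qed (use elim in \<open>simp add: B_def\<close>)
  qed
  from increment_bound[OF this] obtain c where "\<And>n. F d (\<sigma> n) - K * B \<xi> n \<le> c + (\<Sum>j<n. 0)"
    by blast
  then have FB: "F d (\<sigma> n) \<le> c + K * B \<xi> n" for n by (simp add: algebra_simps)
  have "\<forall>\<^sub>F L in at_top. F d L \<le> \<epsilon> * L" if \<epsilon>: "\<epsilon> > 0" for \<epsilon>
  proof (rule from_\<sigma>_to_all)
    show "F d s \<le> F d t" if "0 \<le> s" "s \<le> t" for s t using F_incr[OF that, of d] by simp
    define \<delta> where "\<delta> = \<epsilon> * \<eta> / (2 * K)"
    have \<delta>: "\<delta> > 0" using \<epsilon> K \<eta>_pos by (simp add: \<delta>_def)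
    have \<delta>K: "K * (\<delta> * n) = \<epsilon> * \<eta> / 2 * n" for n :: real using K by (simp add: \<delta>_def)
    have evB: "\<forall>\<^sub>F n in sequentially. B \<xi> (Suc n) \<le> \<delta> * real (Suc n)"
      using B[OF \<delta>] by (rule eventually_sequentially_Suc[THEN iffD2])
    have lin: "\<forall>\<^sub>F n in sequentially. (c + \<epsilon> * \<eta> / 2 - \<epsilon> * (\<sigma> 0 - \<eta>)) + (\<epsilon> * \<eta> / 2) * real n \<le> (\<epsilon> * \<eta>) * real n"
      using \<epsilon> \<eta>_pos by (intro eventually_linear_le) simp
    show "\<forall>\<^sub>F n in sequentially. F d (\<sigma> (Suc n)) \<le> \<epsilon> * \<sigma> n"
      using evB lin
    proof eventually_elim
      case (elim n)
      have "F d (\<sigma> (Suc n)) \<le> c + K * B \<xi> (Suc n)" by (rule FB)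
      also have "K * B \<xi> (Suc n) \<le> K * (\<delta> * real (Suc n))" using elim(1) K by (intro mult_left_mono) auto
      finally have "F d (\<sigma> (Suc n)) \<le> c + \<epsilon> * \<eta> / 2 * real (Suc n)" unfolding \<delta>K by simp
      also have "\<dots> \<le> \<epsilon> * (\<sigma> 0 - \<eta> + \<eta> * n)"
        using elim(2) by (simp add: algebra_simps add_divide_distrib)
      also have "\<dots> \<le> \<epsilon> * \<sigma> n" using \<sigma>_lower'[of n] \<epsilon> by (intro mult_left_mono) auto
      finally show ?case .
    qed
  qed fact
  then show ?thesis using d by blast
qed

text \<open>
  The time outside of the cusp is \<open>O(n)\<close> by \<open>deep\<close>, and \<open>\<sigma> n / n\<close> tends to infinity.
\<close>

lemma A_large_imp_one:
  assumes A: "\<And>K. \<forall>\<^sub>F n in sequentially. K * real n \<le> (\<Sum>j<n. lq j)"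
    and d: "d > 1" and \<epsilon>: "\<epsilon> > 0"
  shows "\<forall>\<^sub>F L in at_top. L - F d L \<le> \<epsilon> * L"
proof (rule from_\<sigma>_to_all)
  show "s - F d s \<le> t - F d t" if "0 \<le> s" "s \<le> t" for s t using F_incr[OF that, of d] by simp
  obtain C where C: "\<forall>\<^sub>F j in sequentially. F d (\<sigma> (Suc j)) - F d (\<sigma> j) \<ge> 2 * l j - C"
    using deep[OF d] by blast
  have "\<forall>\<^sub>F j in sequentially. (\<sigma> (Suc j) - F d (\<sigma> (Suc j))) - (\<sigma> j - F d (\<sigma> j)) \<le> C"
    using C by eventually_elim (simp add: \<sigma>_Suc)
  from increment_bound[OF this] obtain c where c: "\<And>n. \<sigma> n - F d (\<sigma> n) \<le> c + (\<Sum>j<n. C)"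
    by blast
  define K where "K = ln 2 + (\<bar>C\<bar> + 1) / \<epsilon>"
  have \<epsilon>K: "\<epsilon> * (2 * ((K - ln 2) * n)) = 2 * (\<bar>C\<bar> + 1) * n" for n :: real
    using \<epsilon> by (simp add: K_def)
  have lin: "\<forall>\<^sub>F n in sequentially. (c + C - \<epsilon> * \<sigma> 0) + C * real n \<le> (2 * (\<bar>C\<bar> + 1)) * real n"
    by (intro eventually_linear_le) (smt (verit))
  show "\<forall>\<^sub>F n in sequentially. \<sigma> (Suc n) - F d (\<sigma> (Suc n)) \<le> \<epsilon> * \<sigma> n"
    using A[of K] lin
  proof eventually_elim
    case (elim n)
    have "(\<Sum>j<n. lq j) \<le> (\<Sum>j<n. l j + ln 2)"
    proof (rule sum_mono)
      fix j show "lq j \<le> l j + ln 2" using l_near_lq[of j] by linarith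
    qed
    then have "\<sigma> n \<ge> \<sigma> 0 + 2 * ((K - ln 2) * n)"
      using elim(1) unfolding \<sigma>_eq[of n] by (simp add: sum.distrib algebra_simps)
    then have "\<epsilon> * (\<sigma> 0 + 2 * ((K - ln 2) * n)) \<le> \<epsilon> * \<sigma> n" using \<epsilon> by (intro mult_left_mono) auto
    then have "\<epsilon> * \<sigma> 0 + 2 * (\<bar>C\<bar> + 1) * n \<le> \<epsilon> * \<sigma> n" unfolding distrib_left \<epsilon>K .
    then show ?case using c[of "Suc n"] elim(2) by (simp add: algebra_simps)
  qed
qed fact

text \<open>
  The time outside of the cusp is \<open>o(\<sigma> n)\<close> and contains all segments with small digits.  Of any two
  consecutive segments either both have small digits and a total length bounded below, or one has a
  large digit and is much longer than \<open>\<eta>\<close>.  So \<open>\<eta> n\<close> is at most a small multiple of \<open>\<sigma> n\<close>, and this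
  multiple can be chosen freely.
\<close>

lemma one_imp_A_large:
  assumes O: "\<And>d \<epsilon>. d > 1 \<Longrightarrow> \<epsilon> > 0 \<Longrightarrow> \<forall>\<^sub>F L in at_top. L - F d L \<le> \<epsilon> * L"
  shows "\<forall>\<^sub>F n in sequentially. K * real n \<le> (\<Sum>j<n. lq j)"
proof -
  define K' where "K' = 2 * (\<bar>K\<bar> + ln 2 + 1)"
  have ln2: "ln (2::real) > 0" by simp
  have K': "K' > 0" unfolding K'_def using ln2 by (intro mult_pos_pos add_nonneg_pos add_nonneg_nonneg) auto
  \<comment> \<open>\<open>\<theta>\<close> is the fraction of \<open>\<sigma> n\<close> that is allowed in each of the two error terms below, so that in the
    end \<open>\<eta> n\<close> is compared with \<open>2 \<theta> (\<sigma> n)\<close>\<close>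
  define \<theta> where "\<theta> = \<eta> / (4 * K')"
  have \<theta>: "\<theta> > 0" using \<eta>_pos K' by (simp add: \<theta>_def)
  define \<xi> where "\<xi> = exp (\<eta> / \<theta> + ln 2)"
  have \<xi>: "\<xi> > 1" "ln \<xi> = \<eta> / \<theta> + ln 2" using \<eta>_pos \<theta> ln2 by (simp_all add: \<xi>_def add_pos_pos del: ln_gt_zero_iff)
  obtain d where d: "d > 1" and sh: "\<forall>\<^sub>F j in sequentially. \<not> big \<xi> j \<longrightarrow> F d (\<sigma> (Suc j)) = F d (\<sigma> j)"
    using shallow[OF \<xi>(1)] by (auto simp: not_less)
  define s where "s j = (if big \<xi> j then 0 else l j)" for j
  have s0: "s j \<ge> 0" for j using l_nonneg by (simp add: s_def)
  have "\<forall>\<^sub>F j in sequentially. (2 * (\<Sum>i<Suc j. s i) - (\<sigma> (Suc j) - F d (\<sigma> (Suc j)))) -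
      (2 * (\<Sum>i<j. s i) - (\<sigma> j - F d (\<sigma> j))) \<le> 0"
    using sh F_step[of d] by eventually_elim (auto simp: s_def \<sigma>_Suc)
  from increment_bound[OF this] obtain c where "\<And>n. 2 * (\<Sum>i<n. s i) - (\<sigma> n - F d (\<sigma> n)) \<le> c + (\<Sum>j<n. 0)"
    by blast
  then have sG: "2 * (\<Sum>i<n. s i) \<le> c + (\<sigma> n - F d (\<sigma> n))" for n by (simp add: algebra_simps)
  have pair: "\<eta> \<le> (s j + s (Suc j)) + \<theta> * (l j + l (Suc j))" for j
  proof -
    have bigl: "\<theta> * l i \<ge> \<eta>" if "big \<xi> i" for i
    proof -
      have "l i \<ge> \<eta> / \<theta>" using lq_big[OF \<xi>(1) that] \<xi>(2) l_near_lq[of i] by linarith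
      then show ?thesis using \<theta> by (simp add: field_simps)
    qed
    have nn: "\<theta> * l i \<ge> 0" for i using \<theta> l_nonneg by simp
    show ?thesis
      using bigl[of j] bigl[of "Suc j"] nn[of j] nn[of "Suc j"] l_pair[of j] s0[of j] s0[of "Suc j"]
      by (cases "big \<xi> j"; cases "big \<xi> (Suc j)") (auto simp: s_def distrib_left)
  qed
  have evG: "\<forall>\<^sub>F n in sequentially. \<sigma> n - F d (\<sigma> n) \<le> \<theta> * \<sigma> n"
    by (rule eventually_compose_filterlim[OF O[OF d \<theta>] \<sigma>_at_top])
  have lin: "\<forall>\<^sub>F n in sequentially. (\<bar>c\<bar> + \<theta> * \<bar>\<sigma> 0\<bar> + \<eta> + 2 * \<theta> * (\<bar>\<sigma> 0\<bar>)) + (\<eta> / 2) * real n \<le> \<eta> * real n"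
    using \<eta>_pos by (intro eventually_linear_le) simp
  have "\<forall>\<^sub>F n in sequentially. K * real (Suc n) \<le> (\<Sum>j<Suc n. lq j)"
    using evG[THEN eventually_sequentially_Suc[THEN iffD2]] lin[THEN eventually_sequentially_Suc[THEN iffD2]]
  proof eventually_elim
    case (elim n)
    have "\<eta> * n = (\<Sum>j<n. \<eta>)" by simp
    also have "\<dots> \<le> (\<Sum>j<n. (s j + s (Suc j)) + \<theta> * (l j + l (Suc j)))" by (intro sum_mono pair)
    also have "\<dots> = (\<Sum>j<n. s j + s (Suc j)) + \<theta> * (\<Sum>j<n. l j + l (Suc j))"
        by (subst sum.distrib) (simp only: sum_distrib_left)
    also have "\<dots> \<le> 2 * (\<Sum>j<Suc n. s j) + \<theta> * (2 * (\<Sum>j<Suc n. l j))"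
      using \<theta> by (intro add_mono mult_left_mono sum_pair_le s0 l_nonneg) auto
    also have "\<dots> \<le> c + \<theta> * \<sigma> (Suc n) + \<theta> * (\<sigma> (Suc n) - \<sigma> 0)"
      using sG[of "Suc n"] elim(1) \<sigma>_eq[of "Suc n"] by simp
    finally have "\<eta> * n \<le> c + 2 * \<theta> * \<sigma> (Suc n) - \<theta> * \<sigma> 0" by (simp add: algebra_simps)
    moreover have "- (\<theta> * \<sigma> 0) \<le> \<theta> * \<bar>\<sigma> 0\<bar>" using \<theta> by (simp add: abs_if)
    moreover have "2 * \<theta> * \<sigma> 0 \<le> 2 * \<theta> * \<bar>\<sigma> 0\<bar>" using \<theta> by simp
    ultimately have "(\<eta> / 2) * real (Suc n) + 2 * \<theta> * \<sigma> 0 \<le> 2 * \<theta> * \<sigma> (Suc n)"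
      using elim(2) by (simp add: algebra_simps)
    moreover have "\<eta> / 2 = 2 * \<theta> * K'" using K' by (simp add: \<theta>_def)
    ultimately have "2 * \<theta> * (K' * real (Suc n) + \<sigma> 0) \<le> 2 * \<theta> * \<sigma> (Suc n)" by (simp add: algebra_simps)
    then have \<sigma>K: "K' * real (Suc n) + \<sigma> 0 \<le> \<sigma> (Suc n)" using \<theta> by simp
    have "(\<Sum>j<Suc n. l j) \<le> (\<Sum>j<Suc n. lq j + ln 2)"
    proof (rule sum_mono)
      fix j show "l j \<le> lq j + ln 2" using l_near_lq[of j] by linarith
    qed
    also have "\<dots> = (\<Sum>j<Suc n. lq j) + real (Suc n) * ln 2" unfolding sum.distrib by simp
    finally have "K' / 2 * real (Suc n) \<le> (\<Sum>j<Suc n. lq j) + real (Suc n) * ln 2"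
      using \<sigma>K \<sigma>_eq[of "Suc n"] by linarith
    moreover have "(K + ln 2) * real (Suc n) \<le> K' / 2 * real (Suc n)"
      by (intro mult_right_mono) (auto simp: K'_def)
    moreover have "(K + ln 2) * real (Suc n) = K * real (Suc n) + real (Suc n) * ln 2"
      by (simp only: distrib_right mult.commute[of "real (Suc n)"])
    ultimately show ?case by linarith
  qed
  then show ?thesis by (rule eventually_sequentially_Suc[THEN iffD1])
qed

end

lemma log_average_Suc:
  "log_average q (Suc n) = 1 / real (Suc n) * ((if q 0 = 0 then 0 else ln \<bar>real_of_int (q 0)\<bar>) +
     (\<Sum>j<n. if q (Suc j) = 0 then 0 else ln \<bar>real_of_int (q (Suc j))\<bar>))"
  unfolding log_average_def by (simp only: sum.lessThan_Suc_shift)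

lemma ln_abs_int_nonneg: "(if m = 0 then 0 else ln \<bar>real_of_int m\<bar>) \<ge> 0"
proof -
  have "m \<noteq> 0 \<Longrightarrow> \<bar>real_of_int m\<bar> \<ge> 1" by linarith
  then show ?thesis by simp
qed

text \<open>
  The digit with index 0 contributes a constant, so the sums may start with the digit \<open>q 1\<close>, the first
  one that belongs to a segment.
\<close>

lemma log_average_null_iff:
  "log_average q \<longlonglongrightarrow> 0 \<longleftrightarrow>
    (\<forall>\<epsilon>>0. \<forall>\<^sub>F n in sequentially. (\<Sum>j<n. if q (Suc j) = 0 then 0 else ln \<bar>real_of_int (q (Suc j))\<bar>) \<le> \<epsilon> * real n)"
    (is "_ \<longleftrightarrow> (\<forall>\<epsilon>>0. \<forall>\<^sub>F n in sequentially. ?S n \<le> \<epsilon> * real n)")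
proof -
  define f0 where "f0 = (if q 0 = 0 then 0 else ln \<bar>real_of_int (q 0)\<bar>)"
  have f0: "f0 \<ge> 0" unfolding f0_def by (rule ln_abs_int_nonneg)
  have S0: "?S n \<ge> 0" for n by (intro sum_nonneg ln_abs_int_nonneg)
  have "log_average q \<longlonglongrightarrow> 0 \<longleftrightarrow> (\<lambda>n. log_average q (Suc n)) \<longlonglongrightarrow> 0" by (rule filterlim_sequentially_Suc[symmetric])
  also have "(\<lambda>n. log_average q (Suc n)) = (\<lambda>n. 1 / real (Suc n) * (f0 + ?S n))"
    by (simp only: log_average_Suc f0_def)
  also have "(\<lambda>n. 1 / real (Suc n) * (f0 + ?S n)) \<longlonglongrightarrow> 0 \<longleftrightarrow>
      (\<forall>\<epsilon>>0. \<forall>\<^sub>F n in sequentially. f0 + ?S n \<le> \<epsilon> * real (Suc n))"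
    by (rule average_null_iff)
      (use filterlim_compose[OF filterlim_real_sequentially filterlim_Suc] f0 S0 in
        \<open>auto simp: o_def intro!: always_eventually add_nonneg_nonneg\<close>)
  also have "\<dots> \<longleftrightarrow> (\<forall>\<epsilon>>0. \<forall>\<^sub>F n in sequentially. ?S n \<le> \<epsilon> * real n)"
  proof (intro iffI allI impI)
    fix \<epsilon> :: real assume \<epsilon>: "\<epsilon> > 0" and "\<forall>\<epsilon>>0. \<forall>\<^sub>F n in sequentially. f0 + ?S n \<le> \<epsilon> * real (Suc n)"
    then have "\<forall>\<^sub>F n in sequentially. f0 + ?S n \<le> \<epsilon> / 2 * real (Suc n)" using half_gt_zero by blast
    moreover have "\<forall>\<^sub>F n in sequentially. \<epsilon> / 2 + \<epsilon> / 2 * real n \<le> \<epsilon> * real n"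
      using \<epsilon> by (intro eventually_linear_le) simp
    ultimately show "\<forall>\<^sub>F n in sequentially. ?S n \<le> \<epsilon> * real n"
      by eventually_elim (use f0 in \<open>simp add: algebra_simps\<close>)
  next
    fix \<epsilon> :: real assume \<epsilon>: "\<epsilon> > 0" and "\<forall>\<epsilon>>0. \<forall>\<^sub>F n in sequentially. ?S n \<le> \<epsilon> * real n"
    then have "\<forall>\<^sub>F n in sequentially. ?S n \<le> \<epsilon> / 2 * real n" using half_gt_zero by blast
    moreover have "\<forall>\<^sub>F n in sequentially. f0 + \<epsilon> / 2 * real n \<le> \<epsilon> * real n"
      using \<epsilon> by (intro eventually_linear_le) simp
    ultimately show "\<forall>\<^sub>F n in sequentially. f0 + ?S n \<le> \<epsilon> * real (Suc n)"
      by eventually_elim (use \<epsilon> in \<open>simp add: algebra_simps\<close>)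
  qed
  finally show ?thesis .
qed

lemma log_average_at_top_iff:
  "filterlim (log_average q) at_top sequentially \<longleftrightarrow>
    (\<forall>K. \<forall>\<^sub>F n in sequentially. K * real n \<le> (\<Sum>j<n. if q (Suc j) = 0 then 0 else ln \<bar>real_of_int (q (Suc j))\<bar>))"
    (is "_ \<longleftrightarrow> (\<forall>K. \<forall>\<^sub>F n in sequentially. K * real n \<le> ?S n)")
proof -
  define f0 where "f0 = (if q 0 = 0 then 0 else ln \<bar>real_of_int (q 0)\<bar>)"
  have f0: "f0 \<ge> 0" unfolding f0_def by (rule ln_abs_int_nonneg)
  have ge_iff: "K \<le> log_average q (Suc n) \<longleftrightarrow> K * real (Suc n) \<le> f0 + ?S n" for K n
    unfolding log_average_Suc f0_def[symmetric] by (simp add: le_divide_eq mult.commute)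
  have "filterlim (log_average q) at_top sequentially \<longleftrightarrow>
      (\<forall>K. \<forall>\<^sub>F n in sequentially. K \<le> log_average q (Suc n))"
    unfolding filterlim_at_top eventually_sequentially_Suc[of "\<lambda>n. _ \<le> log_average q n"] ..
  also have "\<dots> \<longleftrightarrow> (\<forall>K. \<forall>\<^sub>F n in sequentially. K * real (Suc n) \<le> f0 + ?S n)"
    by (simp only: ge_iff)
  also have "\<dots> \<longleftrightarrow> (\<forall>K. \<forall>\<^sub>F n in sequentially. K * real n \<le> ?S n)"
  proof (intro iffI allI)
    fix K :: real assume "\<forall>K. \<forall>\<^sub>F n in sequentially. K * real (Suc n) \<le> f0 + ?S n"
    then have "\<forall>\<^sub>F n in sequentially. (K + 1) * real (Suc n) \<le> f0 + ?S n" by blast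
    moreover have "\<forall>\<^sub>F n in sequentially. (f0 - K - 1) + K * real n \<le> (K + 1) * real n"
      by (intro eventually_linear_le) simp
    ultimately show "\<forall>\<^sub>F n in sequentially. K * real n \<le> ?S n"
      by eventually_elim (simp add: algebra_simps)
  next
    fix K :: real assume "\<forall>K. \<forall>\<^sub>F n in sequentially. K * real n \<le> ?S n"
    then have "\<forall>\<^sub>F n in sequentially. (K + 1) * real n \<le> ?S n" by blast
    moreover have "\<forall>\<^sub>F n in sequentially. K + K * real n \<le> (K + 1) * real n"
      by (intro eventually_linear_le) simp
    ultimately show "\<forall>\<^sub>F n in sequentially. K * real (Suc n) \<le> f0 + ?S n"
      by eventually_elim (use f0 in \<open>simp add: algebra_simps\<close>)
  qed
  finally show ?thesis .
qed

section \<open>The time a geodesic spends near the cusp\<close>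

lemma integrable_indicator_open:
  assumes "open (W :: real set)" shows "indicat_real W integrable_on {s..t}"
proof -
  have "{s..t} \<inter> W \<in> lmeasurable"
    using assms by (intro fmeasurable_Int_fmeasurable) auto
  then show ?thesis by (simp add: integrable_on_indicator Int_commute)
qed

lemma integral_indicator_increment:
  assumes "open (W :: real set)" "0 \<le> s" "s \<le> t"
  shows "integral {0..t} (indicat_real W) - integral {0..s} (indicat_real W) = integral {s..t} (indicat_real W)"
  using Henstock_Kurzweil_Integration.integral_combine[OF assms(2,3) integrable_indicator_open[OF assms(1)]] by simp

lemma integral_indicator_bounds:
  assumes "open (W :: real set)" "s \<le> t"
  shows "0 \<le> integral {s..t} (indicat_real W)" "integral {s..t} (indicat_real W) \<le> t - s"
proof -
  show "0 \<le> integral {s..t} (indicat_real W)"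
    by (rule Henstock_Kurzweil_Integration.integral_nonneg[OF integrable_indicator_open[OF assms(1)]]) simp
  have "integral {s..t} (indicat_real W) \<le> integral {s..t} (\<lambda>_. 1)"
    by (rule integral_le[OF integrable_indicator_open[OF assms(1)]]) (auto simp: indicator_def)
  then show "integral {s..t} (indicat_real W) \<le> t - s" using assms(2) by simp
qed

lemma integral_indicator_full:
  assumes "{s..t} \<subseteq> W" "s \<le> t"
  shows "integral {s..t} (indicat_real W) = t - s"
proof -
  have "integral {s..t} (indicat_real W) = integral {s..t} (\<lambda>_. 1)"
    by (rule Henstock_Kurzweil_Integration.integral_cong) (use assms in auto)
  then show ?thesis using assms(2) by simp
qed

lemma integral_indicator_disjoint:
  assumes "{s..t} \<inter> W = {}"
  shows "integral {s..t} (indicat_real W) = 0"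
proof -
  have "integral {s..t} (indicat_real W) = integral {s..t} (\<lambda>_. 0)"
    by (rule Henstock_Kurzweil_Integration.integral_cong) (use assms in \<open>auto simp: indicator_def\<close>)
  then show ?thesis by simp
qed

context ab_expansion
begin

text \<open>
  The shift \<open>\<rho> = ln r\<close> places the vertical geodesic \<open>x + \<i> r e\<^sup>-\<^sup>t\<close> that is asymptotic to \<open>e\<close>.  Since the
  two are close only from some time \<open>T\<close> on, \<open>deep\<close> and \<open>shallow\<close> hold for late segments.
\<close>

lemma geodesic_excursion_times:
  assumes e: "hyp_geodesic e" and lim: "(e \<longlongrightarrow> complex_of_real x) at_top"
  obtains \<rho> where "excursion_times (\<lambda>j. \<rho> + cf_time j) (\<lambda>j. ln \<bar>X (Suc j)\<bar>) (ln (1 + \<kappa>))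
    (\<lambda>d L. integral {0..L} (indicat_real {t. e t \<in> high_points d})) D"
proof -
  obtain r where r: "r > 0" and
    close: "\<forall>\<^sub>F t in at_top. norm (e t - Complex x (r * exp (- t))) \<le> r * exp (- t) / 10"
    using cusp_asymptotics[OF e lim] by blast
  define \<rho> where "\<rho> = ln r"
  define W where "W d = {t. e t \<in> high_points d}" for d
  define F where "F d L = integral {0..L} (indicat_real (W d))" for d L
  define \<sigma> where "\<sigma> j = \<rho> + cf_time j" for j
  define z where "z t = Complex x (exp (- (t - \<rho>)))" for t
  have z: "z t = Complex x (r * exp (- t))" for t
    using r by (simp add: z_def \<rho>_def exp_diff exp_minus field_simps)
  obtain T where T: "\<And>t. t \<ge> T \<Longrightarrow> norm (e t - z t) \<le> Im (z t) / 10"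
    using close unfolding eventually_at_top_linorder z by auto
  have zpos: "Im (z t) > 0" for t by (simp add: z_def)
  have epos: "Im (e t) > 0" for t
    using hyp_geodesic_velocity_T1H[OF e, of t] by (simp add: velocity_def T1H_def)
  have cont: "continuous_on UNIV e"
  proof -
    obtain c' where "\<And>t. (e has_vector_derivative c' t) (at t)"
      using e unfolding hyp_geodesic_def by metis
    then show ?thesis by (auto intro!: continuous_at_imp_continuous_on has_vector_derivative_continuous)
  qed
  have openW: "open (W d)" for d
    using open_vimage[OF open_high_points cont, of d] by (simp add: W_def vimage_def)
  have F_diff: "F d t - F d s = integral {s..t} (indicat_real (W d))" if "0 \<le> s" "s \<le> t" for d s t
    unfolding F_def by (rule integral_indicator_increment[OF openW that])
  have F_incr: "0 \<le> F d t - F d s \<and> F d t - F d s \<le> t - s" if "0 \<le> s" "s \<le> t" for d s t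
    using F_diff[OF that, of d] integral_indicator_bounds[OF openW that(2)] by simp
  have l_nonneg: "ln \<bar>X (Suc j)\<bar> \<ge> 0" for j by (rule ln_X_nonneg)
  have \<eta>: "ln (1 + \<kappa>) > 0" using \<kappa>_bounds by simp
  have \<sigma>_Suc: "\<sigma> (Suc j) = \<sigma> j + 2 * ln \<bar>X (Suc j)\<bar>" for j by (simp add: \<sigma>_def cf_time_Suc)
  have \<sigma>_large: "\<forall>\<^sub>F j in sequentially. \<sigma> j \<ge> max 0 T"
  proof -
    interpret growing_times \<sigma> "\<lambda>j. ln \<bar>X (Suc j)\<bar>" "ln (1 + \<kappa>)"
      by unfold_locales (use \<sigma>_Suc l_nonneg \<eta> ln_X_pair in blast)+
    show ?thesis using \<sigma>_at_top by (simp only: filterlim_at_top)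
  qed
  have deep: "\<exists>C. \<forall>\<^sub>F j in sequentially. F d (\<sigma> (Suc j)) - F d (\<sigma> j) \<ge> 2 * ln \<bar>X (Suc j)\<bar> - C"
    if d: "d > 1" for d
  proof -
    \<comment> \<open>the vertical geodesic is followed at level \<open>4 d\<close>, so that \<open>e\<close> itself is at level at least \<open>2 d\<close>\<close>
    define a1 a2 where "a1 = ln (8 * d) - 2 * ln \<kappa>" and "a2 = ln (8 * d)"
    have a: "a1 \<ge> 0" "a2 \<ge> 0"
    proof -
      show "a2 \<ge> 0" using d by (simp add: a2_def)
      moreover have "ln \<kappa> \<le> 0" using \<kappa>_bounds by simp
      ultimately show "a1 \<ge> 0" by (simp add: a1_def a2_def)
    qed
    have "\<forall>\<^sub>F j in sequentially. F d (\<sigma> (Suc j)) - F d (\<sigma> j) \<ge> 2 * ln \<bar>X (Suc j)\<bar> - (a1 + a2)"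
      using \<sigma>_large
    proof eventually_elim
      case (elim j)
      define p q where "p = \<sigma> j + a1" and "q = \<sigma> (Suc j) - a2"
      show ?case
      proof (cases "p \<le> q")
        case True
        have "{p..q} \<subseteq> W d"
        proof
          fix t assume t: "t \<in> {p..q}"
          have "cusp_height (den j) (- num j) (Complex x (exp (- (t - \<rho>)))) \<ge> 4 * d"
            using t d by (intro excursion) (auto simp: p_def q_def \<sigma>_def a1_def a2_def)
          moreover have "norm (e t - z t) \<le> Im (z t) / 10"
            using t elim a by (intro T) (auto simp: p_def)
          from cusp_height_compare(2)[OF zpos this, of "den j" "- num j"]
          have "cusp_height (den j) (- num j) (z t) \<le> 2 * cusp_height (den j) (- num j) (e t)" .
          ultimately have "cusp_height (den j) (- num j) (e t) > d" using d by (simp add: z_def)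
          then have "e t \<in> high_points d"
            unfolding high_points_def using coprime_convergent[of j] epos by blast
          then show "t \<in> W d" by (simp add: W_def)
        qed
        then have "F d q - F d p = q - p"
          using F_diff[of p q d] integral_indicator_full[of p q "W d"] True elim a by (simp add: p_def)
        moreover have "F d p - F d (\<sigma> j) \<ge> 0" using F_incr[of "\<sigma> j" p d] elim a by (simp add: p_def)
        moreover have "F d (\<sigma> (Suc j)) - F d q \<ge> 0"
          using F_incr[of q "\<sigma> (Suc j)" d] elim a True by (simp add: p_def q_def)
        ultimately show ?thesis by (simp add: p_def q_def \<sigma>_Suc)
      next
        case False
        then have "2 * ln \<bar>X (Suc j)\<bar> - (a1 + a2) \<le> 0" by (simp add: p_def q_def \<sigma>_Suc)
        also have "0 \<le> F d (\<sigma> (Suc j)) - F d (\<sigma> j)"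
          using F_incr[of "\<sigma> j" "\<sigma> (Suc j)" d] elim l_nonneg[of j] by (simp add: \<sigma>_Suc)
        finally show ?thesis .
      qed
    qed
    then show ?thesis by blast
  qed
  have shallow: "\<exists>d>1. \<forall>\<^sub>F j in sequentially. \<bar>real_of_int (D (Suc j))\<bar> \<le> \<xi> \<longrightarrow> F d (\<sigma> (Suc j)) = F d (\<sigma> j)"
    if \<xi>: "\<xi> > 1" for \<xi>
  proof -
    \<comment> \<open>\<open>M\<close> bounds the heights on the vertical geodesic; hence \<open>e\<close> stays below \<open>2 M\<close>\<close>
    define H where "H = \<xi> + 1"
    define M where "M = max ((H + 1) / 2) ((1 + \<kappa>\<^sup>2) / \<kappa>\<^sup>2)"
    have "\<forall>\<^sub>F j in sequentially. \<bar>real_of_int (D (Suc j))\<bar> \<le> \<xi> \<longrightarrow> F (2 * M) (\<sigma> (Suc j)) = F (2 * M) (\<sigma> j)"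
      using \<sigma>_large
    proof eventually_elim
      case (elim j)
      show ?case
      proof
        assume small: "\<bar>real_of_int (D (Suc j))\<bar> \<le> \<xi>"
        have "{\<sigma> j..\<sigma> (Suc j)} \<inter> W (2 * M) = {}"
        proof (rule ccontr)
          assume "{\<sigma> j..\<sigma> (Suc j)} \<inter> W (2 * M) \<noteq> {}"
          then obtain t where t: "t \<in> {\<sigma> j..\<sigma> (Suc j)}" "t \<in> W (2 * M)" by blast
          then obtain m n where mn: "coprime m n" "cusp_height m n (e t) > 2 * M"
            by (auto simp: W_def high_points_def)
          have "norm (e t - z t) \<le> Im (z t) / 10" using t elim by (intro T) auto
          from cusp_height_compare(1)[OF zpos this, of m n] mn(2)
          have "cusp_height m n (z t) > M" by simp
          moreover have "cusp_height m n (Complex x (exp (- (t - \<rho>)))) \<le> M"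
            unfolding M_def using t small X_near_D[of j] mn(1)
            by (intro no_excursion[of j]) (auto simp: \<sigma>_def H_def)
          ultimately show False by (simp add: z_def)
        qed
        then have "integral {\<sigma> j..\<sigma> (Suc j)} (indicat_real (W (2 * M))) = 0"
          by (rule integral_indicator_disjoint)
        then show "F (2 * M) (\<sigma> (Suc j)) = F (2 * M) (\<sigma> j)"
          using F_diff[of "\<sigma> j" "\<sigma> (Suc j)" "2 * M"] elim l_nonneg[of j] by (simp add: \<sigma>_Suc)
      qed
    qed
    moreover have "2 * M > 1"
    proof -
      have "(H + 1) / 2 \<le> M" unfolding M_def by (rule max.cobounded1)
      then show ?thesis using \<xi> by (simp add: H_def)
    qed
    ultimately show ?thesis by blast
  qed
  have "excursion_times \<sigma> (\<lambda>j. ln \<bar>X (Suc j)\<bar>) (ln (1 + \<kappa>)) F D"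
    by unfold_locales (use F_incr \<sigma>_Suc l_nonneg \<eta> ln_X_pair D_sign(3) ln_X_near_ln_D deep shallow in blast)+
  then show ?thesis
    by (intro that[of \<rho>]) (simp add: F_def[abs_def] \<sigma>_def[abs_def] W_def)
qed

end

theorem theorem1p1:
  fixes a b x :: real and v :: "tvec set" and c :: "real \<Rightarrow> complex"
  assumes "(a, b) \<in> admissible_params"
    and "v \<in> T1M"
    and "is_lift c v"
    and "(c \<longlongrightarrow> complex_of_real x) at_top"
    and "x \<notin> \<rat>"
  shows "(cusp_frequency_0 v \<longleftrightarrow> (\<exists>\<xi>>1. log_average (cf_quotient_trunc \<xi> a b x) \<longlonglongrightarrow> 0)) \<and>
         (cusp_frequency_1 v \<longleftrightarrow> filterlim (log_average (cf_quotient a b x)) at_top sequentially)"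
proof -
  have "(a, b) \<in> params"
    using assms(1) by (auto simp: admissible_params_def strong_params_def params_def)
  then interpret ab_expansion a b x using assms(5) by unfold_locales
  obtain s where flow: "\<And>t. flowM t v = proj (velocity c (s + t))" using lift_flow[OF assms(3,2)] by blast
  have c: "hyp_geodesic c" using assms(3) by (simp add: is_lift_def)
  define e where "e t = c (s + t)" for t
  have e: "hyp_geodesic e" unfolding e_def by (rule hyp_geodesic_shift(1)[OF c])
  have elim: "(e \<longlongrightarrow> complex_of_real x) at_top"
    unfolding e_def using assms(4)
    by (rule filterlim_compose) (rule filterlim_tendsto_add_at_top[OF tendsto_const filterlim_ident])
  define F where "F d L = integral {0..L} (indicat_real {t. e t \<in> high_points d})" for d L
  have avg: "cusp_average d v L = 1 / L * F d L" for d L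
  proof -
    have "indicat_real (cuspM d) (flowM t v) = indicat_real {t. e t \<in> high_points d} t" for t
      using proj_in_cuspM_iff[OF hyp_geodesic_velocity_T1H[OF c], of "s + t" d]
      by (simp add: flow indicator_def e_def velocity_def)
    then show ?thesis by (simp add: cusp_average_def F_def)
  qed
  obtain \<rho> where "excursion_times (\<lambda>j. \<rho> + cf_time j) (\<lambda>j. ln \<bar>X (Suc j)\<bar>) (ln (1 + \<kappa>)) F D"
    using geodesic_excursion_times[OF e elim] unfolding F_def[abs_def] by blast
  then interpret et: excursion_times "\<lambda>j. \<rho> + cf_time j" "\<lambda>j. ln \<bar>X (Suc j)\<bar>" "ln (1 + \<kappa>)" F D .
  have F0: "F d 0 = 0" for d by (simp add: F_def)
  have Fb: "0 \<le> F d L \<and> F d L \<le> L" if "L \<ge> 0" for d L using et.F_incr[of 0 L d] F0[of d] that by simp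
  have freq0: "(cusp_average d v \<longlongrightarrow> 0) at_top \<longleftrightarrow> (\<forall>\<epsilon>>0. \<forall>\<^sub>F L in at_top. F d L \<le> \<epsilon> * L)" for d
    unfolding avg
    by (rule average_null_iff[OF filterlim_ident eventually_mono[OF eventually_ge_at_top[of 0]]])
      (use Fb in blast)
  have freq1: "(cusp_average d v \<longlongrightarrow> 1) at_top \<longleftrightarrow> (\<forall>\<epsilon>>0. \<forall>\<^sub>F L in at_top. L - F d L \<le> \<epsilon> * L)" for d
  proof -
    have "(cusp_average d v \<longlongrightarrow> 1) at_top \<longleftrightarrow> ((\<lambda>L. 1 - cusp_average d v L) \<longlongrightarrow> 0) at_top"
    proof
      assume "(cusp_average d v \<longlongrightarrow> 1) at_top"
      from tendsto_diff[OF tendsto_const[of 1] this] show "((\<lambda>L. 1 - cusp_average d v L) \<longlongrightarrow> 0) at_top"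
        by simp
    next
      assume "((\<lambda>L. 1 - cusp_average d v L) \<longlongrightarrow> 0) at_top"
      from tendsto_diff[OF tendsto_const[of 1] this] show "(cusp_average d v \<longlongrightarrow> 1) at_top"
        by simp
    qed
    also have "\<dots> \<longleftrightarrow> ((\<lambda>L. 1 / L * (L - F d L)) \<longlongrightarrow> 0) at_top"
      by (rule tendsto_cong, rule eventually_mono[OF eventually_gt_at_top[of 0]]) (simp add: avg field_simps)
    also have "\<dots> \<longleftrightarrow> (\<forall>\<epsilon>>0. \<forall>\<^sub>F L in at_top. L - F d L \<le> \<epsilon> * L)"
      by (rule average_null_iff[OF filterlim_ident eventually_mono[OF eventually_ge_at_top[of 0]]])
        (use Fb in simp)
    finally show ?thesis .
  qed
  have trunc: "(\<Sum>j<n. if cf_quotient_trunc \<xi> a b x (Suc j) = 0 then 0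
        else ln \<bar>real_of_int (cf_quotient_trunc \<xi> a b x (Suc j))\<bar>) = et.B \<xi> n" for \<xi> n
    unfolding et.B_def et.lq_def cf_quotient_trunc_def
    using D_sign(3) by (intro sum.cong) auto
  have full: "(\<Sum>j<n. if D (Suc j) = 0 then 0 else ln \<bar>real_of_int (D (Suc j))\<bar>) = (\<Sum>j<n. et.lq j)" for n
    unfolding et.lq_def using D_sign(3) by (intro sum.cong) auto
  show ?thesis
    unfolding cusp_frequency_0_def cusp_frequency_1_def freq0 freq1
      log_average_null_iff log_average_at_top_iff trunc full
    using et.zero_imp_B_small et.B_small_imp_zero et.A_large_imp_one et.one_imp_A_large
    by (intro conjI iffI) blast+
qed

end
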